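(* Let $X$ be a locally compact separable metrizable space. Then $X$ is a coset space $G/H$ of a locally compact separable metrizable topological group $G$ such that the natural action of $G$ on $X=G/H$ is proper if and only if $X$ is metrically homogeneous with respect to a proper metric, i.e. there exists a proper metric $\rho$ on $X$, compatible with its topology, such that the isometry group $\mathrm{Iso}(X,\rho)$ acts transitively on $X$.
   Context: All spaces (including topological groups) are Tychonoff. A space $X$ is a coset space of a topological group $G$ if $X$ is homeomorphic to $G/H$ (with the quotient topology) for some closed subgroup $H\subset G$; the natural action of $G$ on $G/H$ is $(g,xH)\mapsto (gx)H$. A metric is proper if every ball has compact closure. A continuous action of a topological group $G$ on $X$ is proper if the map $G\times X\to X\times X$, $(g,x)\mapsto(gx,x)$, is perfect. *)

theory Defs
  imports
    "HOL-Analysis.Analysis"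
    "HOL-Algebra.Group_Action"
    "HOL-Algebra.Left_Coset"
begin

section \<open>Topological groups and their coset spaces\<close>

locale topological_group = group G for G :: "('g, 'm) monoid_scheme" (structure) +
  fixes T :: "'g topology"
  assumes topspace_eq_carrier: "topspace T = carrier G"
    and continuous_mult: "continuous_map (prod_topology T T) T (\<lambda>(x, y). x \<otimes> y)"
    and continuous_inv: "continuous_map T T (\<lambda>x. inv x)"

definition coset_topology ::
  "('g, 'm) monoid_scheme \<Rightarrow> 'g topology \<Rightarrow> 'g set \<Rightarrow> 'g set topology" where
  "coset_topology G T H =
     topology (\<lambda>U. U \<subseteq> lcosets\<^bsub>G\<^esub> H \<and> openin T {x \<in> carrier G. x <#\<^bsub>G\<^esub> H \<in> U})"

lemma openin_coset_topology:
  assumes "topspace T = carrier G"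
  shows "openin (coset_topology G T H) U \<longleftrightarrow>
    U \<subseteq> lcosets\<^bsub>G\<^esub> H \<and> openin T {x \<in> carrier G. x <#\<^bsub>G\<^esub> H \<in> U}"
proof -
  let ?P = "\<lambda>U. U \<subseteq> lcosets\<^bsub>G\<^esub> H \<and> openin T {x \<in> carrier G. x <#\<^bsub>G\<^esub> H \<in> U}"
  have "istopology ?P"
    unfolding istopology_def
  proof (intro conjI allI impI)
    fix S S' assume "?P S" "?P S'"
    moreover have "{x \<in> carrier G. x <#\<^bsub>G\<^esub> H \<in> S \<inter> S'} =
      {x \<in> carrier G. x <#\<^bsub>G\<^esub> H \<in> S} \<inter> {x \<in> carrier G. x <#\<^bsub>G\<^esub> H \<in> S'}" by auto
    ultimately show "S \<inter> S' \<subseteq> lcosets\<^bsub>G\<^esub> H"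
      and "openin T {x \<in> carrier G. x <#\<^bsub>G\<^esub> H \<in> S \<inter> S'}" by auto
  next
    fix K assume K: "\<forall>S\<in>K. ?P S"
    then show "\<Union>K \<subseteq> lcosets\<^bsub>G\<^esub> H" by blast
    have "{x \<in> carrier G. x <#\<^bsub>G\<^esub> H \<in> \<Union>K} = (\<Union>S\<in>K. {x \<in> carrier G. x <#\<^bsub>G\<^esub> H \<in> S})" by auto
    then show "openin T {x \<in> carrier G. x <#\<^bsub>G\<^esub> H \<in> \<Union>K}" using K by auto
  qed
  then show ?thesis by (simp add: coset_topology_def topology_inverse')
qed

lemma topspace_coset_topology:
  assumes "topspace T = carrier G"
  shows "topspace (coset_topology G T H) = lcosets\<^bsub>G\<^esub> H"
proof -
  have "{x \<in> carrier G. x <#\<^bsub>G\<^esub> H \<in> lcosets\<^bsub>G\<^esub> H} = topspace T"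
    by (auto simp: LCOSETS_def assms)
  then have "openin (coset_topology G T H) (lcosets\<^bsub>G\<^esub> H)"
    by (simp add: openin_coset_topology[OF assms])
  then show ?thesis
    using openin_coset_topology[OF assms] openin_subset openin_topspace by blast
qed

lemma quotient_map_coset_topology:
  assumes "topspace T = carrier G"
  shows "quotient_map T (coset_topology G T H) (\<lambda>x. x <#\<^bsub>G\<^esub> H)"
  unfolding quotient_map_def topspace_coset_topology[OF assms]
  by (auto simp: assms LCOSETS_def openin_coset_topology)


section \<open>Proper actions\<close>

definition continuous_action ::
  "('g, 'm) monoid_scheme \<Rightarrow> 'g topology \<Rightarrow> 'x topology \<Rightarrow> ('g \<Rightarrow> 'x \<Rightarrow> 'x) \<Rightarrow> bool" where
  "continuous_action G T X \<phi> \<longleftrightarrow>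
     group_action G (topspace X) \<phi> \<and> continuous_map (prod_topology T X) X (\<lambda>(g, x). \<phi> g x)"

text \<open>Perfect means continuous and closed with compact fibres. The library's
  \<^const>\<open>perfect_map\<close> additionally asks for surjectivity, which would restrict proper actions to
  transitive ones, so it is not used here; \<^const>\<open>proper_map\<close> is closedness plus compact fibres.\<close>

definition proper_action ::
  "('g, 'm) monoid_scheme \<Rightarrow> 'g topology \<Rightarrow> 'x topology \<Rightarrow> ('g \<Rightarrow> 'x \<Rightarrow> 'x) \<Rightarrow> bool" where
  "proper_action G T X \<phi> \<longleftrightarrow>
     continuous_action G T X \<phi> \<and>
     continuous_map (prod_topology T X) (prod_topology X X) (\<lambda>(g, x). (\<phi> g x, x)) \<and>
     proper_map (prod_topology T X) (prod_topology X X) (\<lambda>(g, x). (\<phi> g x, x))"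

text \<open>Restricted to the set of cosets because \<^const>\<open>group_action\<close> uses extensional bijections.\<close>

definition coset_action :: "('g, 'm) monoid_scheme \<Rightarrow> 'g set \<Rightarrow> 'g \<Rightarrow> 'g set \<Rightarrow> 'g set" where
  "coset_action G H g = (\<lambda>C\<in>lcosets\<^bsub>G\<^esub> H. g <#\<^bsub>G\<^esub> C)"

lemma (in group) coset_action_coset:
  assumes "H \<subseteq> carrier G" "g \<in> carrier G" "x \<in> carrier G"
  shows "coset_action G H g (x <# H) = (g \<otimes> x) <# H"
  using assms by (auto simp: coset_action_def LCOSETS_def lcos_m_assoc)

lemma (in group) group_action_coset_action:
  assumes "H \<subseteq> carrier G"
  shows "group_action G (lcosets H) (coset_action G H)"
proof -
  have cl: "coset_action G H g C \<in> lcosets H" if "g \<in> carrier G" "C \<in> lcosets H" for g C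
    using that assms coset_action_coset[OF assms] by (fastforce simp: LCOSETS_def)
  have mul: "coset_action G H (g \<otimes> h) C = coset_action G H g (coset_action G H h C)"
    if "g \<in> carrier G" "h \<in> carrier G" "C \<in> lcosets H" for g h C
    using that assms coset_action_coset[OF assms] by (auto simp: LCOSETS_def m_assoc)
  have one: "coset_action G H \<one> C = C" if "C \<in> lcosets H" for C
    using that assms coset_action_coset[OF assms] by (auto simp: LCOSETS_def)
  have bij: "coset_action G H g \<in> Bij (lcosets H)" if g: "g \<in> carrier G" for g
  proof -
    have "bij_betw (coset_action G H g) (lcosets H) (lcosets H)"
      by (rule bij_betw_byWitness[where f' = "coset_action G H (inv g)"])
        (use g cl one mul[of g "inv g", symmetric] mul[of "inv g" g, symmetric] in auto)
    then show ?thesis by (simp add: Bij_def coset_action_def)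
  qed
  have "coset_action G H \<in> hom G (BijGroup (lcosets H))"
  proof (rule homI)
    fix g h assume gh: "g \<in> carrier G" "h \<in> carrier G"
    have "coset_action G H (g \<otimes> h) C =
        compose (lcosets H) (coset_action G H g) (coset_action G H h) C" for C
      using mul[OF gh] by (cases "C \<in> lcosets H") (auto simp: compose_def coset_action_def)
    then show "coset_action G H (g \<otimes> h) =
        coset_action G H g \<otimes>\<^bsub>BijGroup (lcosets H)\<^esub> coset_action G H h"
      using gh bij by (auto simp: BijGroup_def)
  qed (use bij in \<open>simp add: BijGroup_def\<close>)
  then show ?thesis
    by (simp add: group_action_def group_hom_def group_hom_axioms_def group_BijGroup)
qed

definition proper_coset_space ::
  "('g, 'm) monoid_scheme \<Rightarrow> 'g topology \<Rightarrow> 'g set \<Rightarrow> 'x topology \<Rightarrow> bool" where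
  "proper_coset_space G T H X \<longleftrightarrow>
     topological_group G T \<and>
     locally_compact_space T \<and> separable_space T \<and> metrizable_space T \<and>
     subgroup H G \<and> closedin T H \<and>
     X homeomorphic_space coset_topology G T H \<and>
     proper_action G T (coset_topology G T H) (coset_action G H)"


section \<open>Proper metrics and isometry groups\<close>

context Metric_space
begin

definition proper_metric :: bool where
  "proper_metric \<longleftrightarrow> (\<forall>x\<in>M. \<forall>r. compactin mtopology (mtopology closure_of mball x r))"

definition isometry_group :: "('a \<Rightarrow> 'a) monoid" where
  "isometry_group = (BijGroup M)
     \<lparr>carrier := {f \<in> Bij M. \<forall>x\<in>M. \<forall>y\<in>M. d (f x) (f y) = d x y}\<rparr>"

lemma subgroup_isometries: "subgroup (carrier isometry_group) (BijGroup M)"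
proof (rule group.subgroupI[OF group_BijGroup])
  show "carrier isometry_group \<subseteq> carrier (BijGroup M)"
    by (auto simp: isometry_group_def BijGroup_def)
  have "(\<lambda>x\<in>M. x) \<in> carrier isometry_group"
    by (simp add: isometry_group_def id_Bij)
  then show "carrier isometry_group \<noteq> {}" by blast
next
  fix f assume "f \<in> carrier isometry_group"
  then have f: "f \<in> Bij M" "\<And>x y. x \<in> M \<Longrightarrow> y \<in> M \<Longrightarrow> d (f x) (f y) = d x y"
    by (auto simp: isometry_group_def)
  then have surj: "f ` M = M" by (simp add: Bij_def bij_betw_def)
  have "d (inv_into M f x) (inv_into M f y) = d x y" if "x \<in> M" "y \<in> M" for x y
    using f(2)[of "inv_into M f x" "inv_into M f y"] that surj
    by (simp add: f_inv_into_f inv_into_into)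
  then show "inv\<^bsub>BijGroup M\<^esub> f \<in> carrier isometry_group"
    using f(1) by (simp add: isometry_group_def inv_BijGroup restrict_inv_into_Bij)
next
  fix f g assume "f \<in> carrier isometry_group" "g \<in> carrier isometry_group"
  then show "f \<otimes>\<^bsub>BijGroup M\<^esub> g \<in> carrier isometry_group"
    using Bij_imp_funcset[of g M]
    by (auto simp: isometry_group_def BijGroup_def compose_Bij compose_eq Pi_iff)
qed

lemma group_action_isometry_group: "group_action isometry_group M (\<lambda>f. f)"
proof -
  have eq: "(BijGroup M)\<lparr>carrier := carrier isometry_group\<rparr> = isometry_group"
    by (simp add: isometry_group_def)
  have "group isometry_group"
    using subgroup.subgroup_is_group[OF subgroup_isometries group_BijGroup] by (simp add: eq)
  moreover have "(\<lambda>f. f) \<in> hom isometry_group (BijGroup M)"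
    by (rule homI) (auto simp: isometry_group_def BijGroup_def)
  ultimately show ?thesis
    by (simp add: group_action_def group_hom_def group_hom_axioms_def group_BijGroup)
qed

lemma transitive_isometry_group_iff:
  "transitive_action isometry_group M (\<lambda>f. f) \<longleftrightarrow>
     (\<forall>x\<in>M. \<forall>y\<in>M. \<exists>f\<in>carrier isometry_group. f x = y)"
  by (auto simp: transitive_action_def transitive_action_axioms_def group_action_isometry_group)

end

definition metrically_homogeneous_proper :: "'a topology \<Rightarrow> bool" where
  "metrically_homogeneous_proper X \<longleftrightarrow>
     (\<exists>\<rho>. Metric_space (topspace X) \<rho> \<and>
          Metric_space.mtopology (topspace X) \<rho> = X \<and>
          Metric_space.proper_metric (topspace X) \<rho> \<and>
          transitive_action (Metric_space.isometry_group (topspace X) \<rho>) (topspace X) (\<lambda>f. f))"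

end

theory Submission
  imports Defs "HOL-Algebra.Weak_Morphisms"
begin

text \<open>
For the forward direction, let \<open>G\<close> act properly on \<open>G/H\<close>. Then \<open>H\<close> is compact, being homeomorphic to a fibre of a
perfect map, and a \<open>G\<close>-invariant proper metric on \<open>G/H\<close> is obtained in the manner of Birkhoff, Kakutani and
Struble. One chooses relatively compact symmetric open sets \<open>V n \<supseteq> H\<close>, indexed by all integers, such
that products of five elements of \<open>V n\<close> lie in \<open>V (n + 1)\<close>, the union of the \<open>V n\<close> is \<open>G\<close>, and the \<open>V n\<close> form a
neighbourhood base of \<open>H\<close> as \<open>n\<close> tends to \<open>-\<infinity>\<close> (\<open>tame_filtration\<close>). The cosets \<open>xH\<close> and \<open>yH\<close> count as
\<open>2\<^sup>n\<close>-close if \<open>inv x \<otimes> y \<in> V n\<close> for suitable representatives. The infimum of the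
weights of chains of such steps is a metric, and Frink's lemma (\<open>chain_subset_scale\<close>) compares its
balls with the sets \<open>V n\<close>: small balls give the quotient topology and all balls are relatively compact. The
metric is built from left-invariant data, so left translations are isometries, and they act
transitively.

For the converse, let \<open>\<rho>\<close> be a proper metric with transitive isometry group, and give this group the topology
of pointwise convergence. It is metrizable because a countable dense set of points suffices to test
convergence. The isometries that move a base point by at most \<open>r\<close> form a compact set
(\<open>compactin_bounded_displacement\<close>): a pair of mutually inverse isometries is the same as a pair \<open>(f, h)\<close>
with \<open>\<rho> (f z) x = \<rho> z (h x)\<close>, which is a pointwise closed condition, and Tychonoff's theorem applies. From this
one reads off that the group is locally compact and \<open>\<sigma>\<close>-compact, hence separable, and that the action and the
orbit maps are perfect. An orbit map is then a quotient map and identifies the space, equivariantly, with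
the cosets of a stabilizer (\<open>proper_coset_space_stabilizer\<close>). As a separable metrizable
space the group has at most continuum many elements, so a copy of it lives on a set of reals.
\<close>


section \<open>The chain metric of a scale of relations\<close>

text \<open>A uniform structure given by relations \<open>E n\<close>, one for each scale \<open>2\<^sup>n\<close> with \<open>n\<close> an arbitrary
integer: the small scales determine the topology and the large ones the bounded sets. Asking that three
steps of scale \<open>n\<close> make one of scale \<open>n + 1\<close>, rather than two, is what makes chains controllable in
\<open>chain_subset_scale\<close>.\<close>

locale metric_scales =
  fixes M :: "'a set" and E :: "int \<Rightarrow> 'a rel"
  assumes scale_subset: "E n \<subseteq> M \<times> M"
    and scale_refl: "x \<in> M \<Longrightarrow> (x, x) \<in> E n"
    and scale_sym: "(x, y) \<in> E n \<Longrightarrow> (y, x) \<in> E n"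
    and scale_triple: "E n O E n O E n \<subseteq> E (n + 1)"
    and scale_separates: "(\<And>n. (x, y) \<in> E n) \<Longrightarrow> x = y"
    and scale_exhausts: "x \<in> M \<Longrightarrow> y \<in> M \<Longrightarrow> \<exists>n. (x, y) \<in> E n"
begin

primrec chain :: "int list \<Rightarrow> 'a rel" where
  "chain [] = Id_on M"
| "chain (n # ns) = E n O chain ns"

definition weight :: "int list \<Rightarrow> real" where
  "weight ns = (\<Sum>n\<leftarrow>ns. 2 powi n)"

definition chain_dist :: "'a \<Rightarrow> 'a \<Rightarrow> real" where
  "chain_dist x y = Inf {weight ns | ns. (x, y) \<in> chain ns}"

lemma weight_simps [simp]:
  "weight [] = 0" "weight (n # ns) = 2 powi n + weight ns"
  "weight (ms @ ns) = weight ms + weight ns" "weight (rev ns) = weight ns"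
  by (auto simp: weight_def simp flip: rev_map)

lemma weight_nonneg [simp]: "0 \<le> weight ns"
  by (induction ns) auto

lemma chain_subset: "chain ns \<subseteq> M \<times> M"
  by (induction ns) (use scale_subset in auto)

lemma chain_append: "chain (ms @ ns) = chain ms O chain ns"
proof (induction ms)
  case Nil
  then show ?case using chain_subset[of ns] by auto
qed (simp add: O_assoc)

lemma chain_rev: "(x, y) \<in> chain ns \<Longrightarrow> (y, x) \<in> chain (rev ns)"
proof (induction ns arbitrary: x)
  case (Cons n ns)
  then obtain z where z: "(x, z) \<in> E n" "(z, y) \<in> chain ns" by auto
  moreover have "x \<in> M" using z scale_subset by blast
  ultimately have "(z, x) \<in> chain [n]" using scale_sym by auto
  with Cons.IH[OF z(2)] show ?case by (auto simp: chain_append)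
qed auto

lemma scale_mono:
  assumes "m \<le> n"
  shows "E m \<subseteq> E n"
  using assms
proof (induction n rule: int_ge_induct)
  case (step i)
  have "E i \<subseteq> E (i + 1)"
  proof
    fix p assume p: "p \<in> E i"
    obtain x y where [simp]: "p = (x, y)" by force
    have "x \<in> M" "y \<in> M" using p scale_subset by auto
    then have "p \<in> E i O E i O E i" using p scale_refl by auto
    then show "p \<in> E (i + 1)" using scale_triple by blast
  qed
  with step show ?case by blast
qed auto

text \<open>The cut used in Frink's argument: the entry \<open>m\<close> is the first one at which the partial weight
reaches \<open>c\<close>, so that both the part before it and, when the total weight is below \<open>2c\<close>, the part after it
weigh less than \<open>c\<close>. If the partial weights never reach \<open>c\<close>, the last entry serves as \<open>m\<close>.\<close>

lemma prefix_below_weight: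
  assumes "0 < c" "ns \<noteq> []"
  obtains as m bs where "ns = as @ m # bs" "weight as < c" "bs = [] \<or> c \<le> weight (as @ [m])"
  using assms(2)
proof (induction ns arbitrary: thesis rule: rev_induct)
  case (snoc n ns)
  show ?case
  proof (cases "weight ns < c")
    case True
    show ?thesis by (rule snoc.prems(1)[of ns n "[]"]) (use True in auto)
  next
    case False
    with \<open>0 < c\<close> have "ns \<noteq> []" by auto
    then obtain as m bs where "ns = as @ m # bs" "weight as < c" "bs = [] \<or> c \<le> weight (as @ [m])"
      using snoc.IH by blast
    with False show ?thesis by (intro snoc.prems(1)[of as m "bs @ [n]"]) auto
  qed
qed auto

text \<open>Frink's metrization lemma. A chain of weight below \<open>2\<^sup>n\<close> is cut into a head and a tail of weight
below \<open>2\<^sup>n\<^sup>-\<^sup>1\<close> and one link between them; by induction on the length the head and the tail lie in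
\<open>E (n - 1)\<close>, and so does the link, because its own weight is below \<open>2\<^sup>n\<close> and so its
scale is at most \<open>n - 1\<close>. The triple condition puts
these three steps together.\<close>

lemma chain_subset_scale:
  assumes "weight ns < 2 powi n"
  shows "chain ns \<subseteq> E n"
  using assms
proof (induction "length ns" arbitrary: ns n rule: less_induct)
  case less
  show ?case
  proof (cases "ns = []")
    case True
    then show ?thesis using scale_refl by auto
  next
    case False
    have half: "2 powi n = 2 * (2 powi (n - 1) :: real)"
      by (simp add: power_int_diff)
    obtain as m bs where ns: "ns = as @ m # bs" and as: "weight as < 2 powi (n - 1)"
      and bs: "bs = [] \<or> 2 powi (n - 1) \<le> weight (as @ [m])"
      using prefix_below_weight[of "2 powi (n - 1)" ns] False by auto
    have "weight bs < 2 powi (n - 1)" using bs less.prems half ns by auto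
    then have "chain bs \<subseteq> E (n - 1)" using less.hyps[of bs "n - 1"] ns by auto
    moreover have "chain as \<subseteq> E (n - 1)" using less.hyps[of as "n - 1"] ns as by auto
    moreover have "E m \<subseteq> E (n - 1)"
    proof (rule scale_mono)
      have "(2::real) powi m < 2 powi n"
        using less.prems weight_nonneg[of as] weight_nonneg[of bs] unfolding ns weight_simps
        by linarith
      then have "\<not> n \<le> m" using power_int_increasing[of n m "2::real"] by auto
      then show "m \<le> n - 1" by simp
    qed
    ultimately have "chain ns \<subseteq> E (n - 1) O E (n - 1) O E (n - 1)"
      unfolding ns chain_append chain.simps by (intro relcomp_mono)
    then show ?thesis using scale_triple[of "n - 1"] by auto
  qed
qed

lemma chain_dist_le: "(x, y) \<in> chain ns \<Longrightarrow> chain_dist x y \<le> weight ns"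
  unfolding chain_dist_def by (rule cInf_lower) (auto intro!: bdd_belowI[of _ 0])

lemma chain_exists:
  assumes "x \<in> M" "y \<in> M"
  shows "\<exists>ns. (x, y) \<in> chain ns"
proof -
  obtain n where "(x, y) \<in> E n" using scale_exhausts assms by blast
  then have "(x, y) \<in> chain [n]" using assms by auto
  then show ?thesis by blast
qed

lemma chain_dist_less:
  assumes "x \<in> M" "y \<in> M" "chain_dist x y < c"
  obtains ns where "(x, y) \<in> chain ns" "weight ns < c"
  using assms chain_exists[OF assms(1,2)] unfolding chain_dist_def
  by (subst (asm) cInf_less_iff) (auto intro!: bdd_belowI[of _ 0])

lemma scale_imp_chain_dist_le: "(x, y) \<in> E n \<Longrightarrow> chain_dist x y \<le> 2 powi n"
  using chain_dist_le[of x y "[n]"] scale_subset by auto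

lemma chain_dist_less_imp_scale:
  "x \<in> M \<Longrightarrow> y \<in> M \<Longrightarrow> chain_dist x y < 2 powi n \<Longrightarrow> (x, y) \<in> E n"
  using chain_dist_less chain_subset_scale by (metis subsetD)

lemma chain_dist_nonneg: "x \<in> M \<Longrightarrow> y \<in> M \<Longrightarrow> 0 \<le> chain_dist x y"
  unfolding chain_dist_def by (rule cInf_greatest) (use chain_exists in auto)

lemma chain_dist_commute: "chain_dist x y = chain_dist y x"
proof -
  have *: "{weight ns | ns. (x, y) \<in> chain ns} \<subseteq> {weight ns | ns. (y, x) \<in> chain ns}" for x y
  proof
    fix w assume "w \<in> {weight ns | ns. (x, y) \<in> chain ns}"
    then obtain ns where "w = weight ns" "(x, y) \<in> chain ns" by blast
    then have "(y, x) \<in> chain (rev ns)" "w = weight (rev ns)" using chain_rev[of x y ns] by simp_all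
    then show "w \<in> {weight ns | ns. (y, x) \<in> chain ns}" by blast
  qed
  show ?thesis
    unfolding chain_dist_def by (rule arg_cong[of _ _ Inf], rule subset_antisym) (rule *)+
qed

lemma chain_dist_triangle:
  assumes "x \<in> M" "y \<in> M" "z \<in> M"
  shows "chain_dist x z \<le> chain_dist x y + chain_dist y z"
proof (rule field_le_epsilon)
  fix e :: real assume "e > 0"
  obtain ms where ms: "(x, y) \<in> chain ms" "weight ms < chain_dist x y + e / 2"
    using chain_dist_less[of x y "chain_dist x y + e / 2"] assms \<open>e > 0\<close> by auto
  obtain ns where ns: "(y, z) \<in> chain ns" "weight ns < chain_dist y z + e / 2"
    using chain_dist_less[of y z "chain_dist y z + e / 2"] assms \<open>e > 0\<close> by auto
  have "(x, z) \<in> chain (ms @ ns)" using ms ns by (auto simp: chain_append)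
  then have "chain_dist x z \<le> weight ms + weight ns" using chain_dist_le by fastforce
  with ms ns show "chain_dist x z \<le> chain_dist x y + chain_dist y z + e" by linarith
qed

lemma chain_dist_zero:
  assumes "x \<in> M" "y \<in> M"
  shows "chain_dist x y = 0 \<longleftrightarrow> x = y"
proof
  assume "chain_dist x y = 0"
  then show "x = y" using chain_dist_less_imp_scale assms by (intro scale_separates) auto
next
  assume "x = y"
  then have "(x, y) \<in> chain []" using assms by auto
  then show "chain_dist x y = 0"
    using chain_dist_le chain_dist_nonneg[OF assms] by fastforce
qed

text \<open>Off \<open>M\<close> the chain distance is an infimum of the empty set, whereas a metric has to be nonnegative
everywhere; hence the default value.\<close>
definition scale_dist :: "'a \<Rightarrow> 'a \<Rightarrow> real" where
  "scale_dist x y = (if x \<in> M \<and> y \<in> M then chain_dist x y else 0)"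

lemma Metric_space_scale_dist: "Metric_space M scale_dist"
proof unfold_locales
  show "0 \<le> scale_dist x y" for x y by (simp add: scale_dist_def chain_dist_nonneg)
  show "scale_dist x y = scale_dist y x" for x y
    using chain_dist_commute[of x y] by (simp add: scale_dist_def)
  show "scale_dist x y = 0 \<longleftrightarrow> x = y" if "x \<in> M" "y \<in> M" for x y
    using that by (simp add: scale_dist_def chain_dist_zero)
  show "scale_dist x z \<le> scale_dist x y + scale_dist y z" if "x \<in> M" "y \<in> M" "z \<in> M" for x y z
    using that chain_dist_triangle[of x y z] by (simp add: scale_dist_def)
qed

sublocale Metric_space M scale_dist by (rule Metric_space_scale_dist)

text \<open>The distance is defined from the relations alone, so whatever preserves them preserves it.\<close>

lemma chain_invariant:
  assumes "\<And>x. x \<in> M \<Longrightarrow> f x \<in> M" "\<And>n x y. (x, y) \<in> E n \<Longrightarrow> (f x, f y) \<in> E n"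
    and "(x, y) \<in> chain ns"
  shows "(f x, f y) \<in> chain ns"
  using assms(3)
proof (induction ns arbitrary: x)
  case Nil
  then have "x \<in> M" "x = y" by auto
  with assms(1)[of x] show ?case by (simp add: Id_onI)
next
  case (Cons n ns)
  from Cons.prems obtain z where z: "(x, z) \<in> E n" "(z, y) \<in> chain ns" by auto
  show ?case using assms(2)[OF z(1)] Cons.IH[OF z(2)] by (simp add: relcompI)
qed

lemma scale_dist_isometry:
  assumes f: "bij_betw f M M" and inv: "\<And>n x y. x \<in> M \<Longrightarrow> y \<in> M \<Longrightarrow> (f x, f y) \<in> E n \<longleftrightarrow> (x, y) \<in> E n"
    and xy: "x \<in> M" "y \<in> M"
  shows "scale_dist (f x) (f y) = scale_dist x y"
proof -
  let ?g = "inv_into M f"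
  have fM: "f x \<in> M" if "x \<in> M" for x using f that by (auto simp: bij_betw_def)
  have g: "?g x \<in> M" "f (?g x) = x" if "x \<in> M" for x
    using f that by (auto simp: bij_betw_def inv_into_into f_inv_into_f)
  have 1: "(f x, f y) \<in> E n" if "(x, y) \<in> E n" for x y n
    using that inv[of x y n] scale_subset by blast
  have 2: "(?g x, ?g y) \<in> E n" if "(x, y) \<in> E n" for x y n
    using that inv[of "?g x" "?g y" n] scale_subset[of n] g by auto
  have gf: "?g (f x) = x" if "x \<in> M" for x using f that by (auto simp: bij_betw_def)
  have "(f x, f y) \<in> chain ns \<longleftrightarrow> (x, y) \<in> chain ns" for ns
    using chain_invariant[of f, OF fM 1] chain_invariant[of ?g "f x" "f y", OF g(1) 2] gf xy
    by metis
  then show ?thesis using xy fM by (simp add: scale_dist_def chain_dist_def)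
qed

text \<open>The ball of radius \<open>2\<^sup>n\<close> about \<open>x\<close> lies in \<open>E n `` {x}\<close>, by Frink's lemma, and contains
\<open>E (n - 1) `` {x}\<close>. So balls and scale neighbourhoods are interchangeable.\<close>

lemma mtopology_scale_dist:
  assumes X: "topspace X = M"
    and nhd: "\<And>U. U \<subseteq> M \<Longrightarrow> openin X U \<longleftrightarrow> (\<forall>x\<in>U. \<exists>n. E n `` {x} \<subseteq> U)"
  shows "mtopology = X"
proof -
  have ball: "mball x (2 powi n) \<subseteq> E n `` {x}" for x n
    using chain_dist_less_imp_scale by (auto simp: scale_dist_def)
  have scale: "E n `` {x} \<subseteq> mball x r" if "2 powi n < r" for x n r
    proof clarify
    fix y assume xy: "(x, y) \<in> E n"
    then have "x \<in> M" "y \<in> M" using scale_subset by auto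
    then show "y \<in> mball x r"
      using scale_imp_chain_dist_le[OF xy] that by (simp add: scale_dist_def)
  qed
  have small: "\<exists>n. 2 powi n < r" if r: "0 < r" for r :: real
  proof -
    obtain k where "(1 / 2 :: real) ^ k < r"
      using real_arch_pow_inv[OF r, of "1 / 2"] by auto
    then have "2 powi (- int k) < r"
      by (simp add: power_int_minus power_one_over inverse_eq_divide)
    then show ?thesis by blast
  qed
  have "openin mtopology U \<longleftrightarrow> openin X U" for U
  proof (cases "U \<subseteq> M")
    case True
    have "(\<exists>r>0. mball x r \<subseteq> U) \<longleftrightarrow> (\<exists>n. E n `` {x} \<subseteq> U)" for x
    proof
      assume "\<exists>r>0. mball x r \<subseteq> U"
      then show "\<exists>n. E n `` {x} \<subseteq> U" using small scale by (meson order_trans)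
    next
      assume "\<exists>n. E n `` {x} \<subseteq> U"
      then obtain n where "E n `` {x} \<subseteq> U" ..
      then have "mball x (2 powi n) \<subseteq> U" using ball[of x n] by blast
      then show "\<exists>r>0. mball x r \<subseteq> U" by (intro exI[of _ "2 powi n"]) auto
    qed
    then show ?thesis using True by (simp add: openin_mtopology nhd Ball_def)
  next
    case False
    then show ?thesis using openin_subset X topspace_mtopology by metis
  qed
  then show ?thesis by (simp add: topology_eq)
qed

lemma proper_metric_scale_dist:
  assumes "\<And>x n. x \<in> M \<Longrightarrow> \<exists>K. compactin mtopology K \<and> E n `` {x} \<subseteq> K"
  shows "proper_metric"
  unfolding proper_metric_def
proof (intro ballI allI)
  fix x and r :: real assume x: "x \<in> M"
  obtain k where k: "r < 2 ^ k" using real_arch_pow[of 2 r] by auto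
  have "mball x r \<subseteq> E (int k) `` {x}"
    using chain_dist_less_imp_scale[of x _ "int k"] k by (auto simp: scale_dist_def)
  moreover obtain K where K: "compactin mtopology K" "E (int k) `` {x} \<subseteq> K"
    using assms[OF x] by blast
  ultimately have "mtopology closure_of mball x r \<subseteq> K"
    by (intro closure_of_minimal) (use compactin_imp_closedin[OF Hausdorff_space_mtopology] in auto)
  then show "compactin mtopology (mtopology closure_of mball x r)"
    using closed_compactin[OF K(1)] by simp
qed

end


section \<open>Neighbourhoods of a compact subgroup\<close>

context topological_group
begin

lemma open_subset_carrier: "openin T U \<Longrightarrow> U \<subseteq> carrier G"
  using openin_subset[of T U] topspace_eq_carrier by simp

lemma compact_subset_carrier: "compactin T K \<Longrightarrow> K \<subseteq> carrier G"
  using compactin_subset_topspace[of T K] topspace_eq_carrier by simp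

lemma continuous_mult_map:
  assumes "continuous_map Y T f" "continuous_map Y T g"
  shows "continuous_map Y T (\<lambda>y. f y \<otimes> g y)"
proof -
  have "continuous_map Y T ((\<lambda>(x, y). x \<otimes> y) \<circ> (\<lambda>y. (f y, g y)))"
    by (rule continuous_map_compose[OF _ continuous_mult]) (intro continuous_map_pairedI assms)
  then show ?thesis by (simp add: o_def)
qed

lemma continuous_left_translation:
  "a \<in> carrier G \<Longrightarrow> continuous_map T T (\<lambda>x. a \<otimes> x)"
  by (intro continuous_mult_map) (auto simp: topspace_eq_carrier)

lemma openin_left_translation:
  assumes "a \<in> carrier G" "openin T U"
  shows "openin T {x \<in> carrier G. a \<otimes> x \<in> U}"
  using openin_continuous_map_preimage[OF continuous_left_translation[OF assms(1)] assms(2)]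
  by (simp add: topspace_eq_carrier)

lemma openin_inverse_set:
  assumes "openin T U"
  shows "openin T {x \<in> carrier G. inv x \<in> U}"
  using openin_continuous_map_preimage[OF continuous_inv assms] by (simp add: topspace_eq_carrier)

lemma compactin_set_mult:
  assumes "compactin T K" "compactin T L"
  shows "compactin T (K <#> L)"
proof -
  have "compactin T ((\<lambda>(x, y). x \<otimes> y) ` (K \<times> L))"
    by (rule image_compactin[OF _ continuous_mult]) (simp add: compactin_Times assms)
  moreover have "(\<lambda>(x, y). x \<otimes> y) ` (K \<times> L) = K <#> L" by (auto simp: set_mult_def)
  ultimately show ?thesis by simp
qed

lemma compactin_left_translate:
  assumes "a \<in> carrier G" "compactin T K"
  shows "compactin T ((\<lambda>x. a \<otimes> x) ` K)"
  using image_compactin[OF assms(2) continuous_left_translation[OF assms(1)]] .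

lemma inv_mult_cancel: "x \<in> carrier G \<Longrightarrow> y \<in> carrier G \<Longrightarrow> inv x \<otimes> (x \<otimes> y) = y"
  by (simp flip: m_assoc)

lemma mult_inv_cancel: "x \<in> carrier G \<Longrightarrow> y \<in> carrier G \<Longrightarrow> x \<otimes> (inv x \<otimes> y) = y"
  by (simp flip: m_assoc)

lemma telescope_inv_mult:
  "x \<in> carrier G \<Longrightarrow> y \<in> carrier G \<Longrightarrow> z \<in> carrier G \<Longrightarrow> (inv x \<otimes> y) \<otimes> (inv y \<otimes> z) = inv x \<otimes> z"
  by (simp add: m_assoc mult_inv_cancel)

lemma set_multI: "a \<in> A \<Longrightarrow> b \<in> B \<Longrightarrow> a \<otimes> b \<in> A <#> B"
  by (auto simp: set_mult_def)

lemma l_coset_eq_iff: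
  assumes H: "subgroup H G" and xy: "x \<in> carrier G" "y \<in> carrier G"
  shows "x <#\<^bsub>G\<^esub> H = y <#\<^bsub>G\<^esub> H \<longleftrightarrow> inv x \<otimes> y \<in> H"
proof
  assume "x <#\<^bsub>G\<^esub> H = y <#\<^bsub>G\<^esub> H"
  then have "y \<in> x <#\<^bsub>G\<^esub> H" using lcos_self[OF xy(2) H] by simp
  then show "inv x \<otimes> y \<in> H" by (rule subgroup.lcos_module_imp[OF H is_group xy(1)])
next
  assume "inv x \<otimes> y \<in> H"
  then have "y \<in> x <#\<^bsub>G\<^esub> H" by (rule subgroup.lcos_module_rev[OF H is_group xy])
  then show "x <#\<^bsub>G\<^esub> H = y <#\<^bsub>G\<^esub> H" by (rule l_repr_independence[OF _ xy(1) H])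
qed

lemma set_mult_subset_iff:
  "A <#> B \<subseteq> C \<longleftrightarrow> (\<forall>a\<in>A. \<forall>b\<in>B. a \<otimes> b \<in> C)"
  by (auto simp: set_mult_def)

text \<open>Multiplication maps \<open>H \<times> H\<close> into \<open>H\<close>, so the preimage of \<open>W\<close> is an open set around the compact
rectangle \<open>H \<times> H\<close>; Wallace's theorem fits an open rectangle in between.\<close>

lemma open_subgroup_neighbourhood_square:
  assumes "subgroup H G" "compactin T H" "openin T W" "H \<subseteq> W"
  obtains V where "openin T V" "H \<subseteq> V" "V <#> V \<subseteq> W"
proof -
  let ?m = "\<lambda>(x, y). x \<otimes> y"
  let ?P = "{p \<in> topspace (prod_topology T T). ?m p \<in> W}"
  have "openin (prod_topology T T) ?P"
    by (rule openin_continuous_map_preimage[OF continuous_mult assms(3)])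
  moreover have "H \<times> H \<subseteq> ?P"
    using assms subgroup.m_closed[OF assms(1)] compact_subset_carrier[OF assms(2)]
    by (auto simp: topspace_eq_carrier)
  ultimately obtain U V where UV: "openin T U" "openin T V" "H \<subseteq> U" "H \<subseteq> V" "U \<times> V \<subseteq> ?P"
    by (rule Wallace_theorem_prod_topology[OF assms(2,2)])
  show ?thesis
  proof (rule that)
    show "openin T (U \<inter> V)" "H \<subseteq> U \<inter> V" using UV by auto
    show "(U \<inter> V) <#> (U \<inter> V) \<subseteq> W" using UV(5) by (auto simp: set_mult_def)
  qed
qed

lemma set_mult_subset_left:
  assumes "\<one> \<in> B" "A \<subseteq> carrier G"
  shows "A \<subseteq> A <#> B"
proof
  fix a assume "a \<in> A"
  then have "a = a \<otimes> \<one>" using assms(2) by auto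
  with \<open>a \<in> A\<close> assms(1) show "a \<in> A <#> B" unfolding set_mult_def by blast
qed

text \<open>These neighbourhoods give symmetric relations with relatively compact sections on the quotient.\<close>

definition tame_neighbourhood :: "'g set \<Rightarrow> 'g set \<Rightarrow> bool" where
  "tame_neighbourhood H V \<longleftrightarrow>
     openin T V \<and> H \<subseteq> V \<and> (\<forall>x\<in>V. inv x \<in> V) \<and> (\<exists>K. compactin T K \<and> V \<subseteq> K)"

text \<open>Three steps \<open>xH \<rightarrow> yH \<rightarrow> zH \<rightarrow> wH\<close> in the quotient, each by an element of \<open>V\<close>, involve two changes of
representative in between. When \<open>H \<subseteq> V\<close> these changes are again elements of \<open>V\<close>, so in the group
the three steps become a product of five factors from \<open>V\<close>.\<close>

definition quintuple :: "'g set \<Rightarrow> 'g set" where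
  "quintuple V = V <#> V <#> V <#> V <#> V"

text \<open>Three successive square roots of a neighbourhood of \<open>H\<close> leave room for eight factors, hence for
five.\<close>

lemma smaller_tame_neighbourhood:
  assumes H: "subgroup H G" "compactin T H" and V: "tame_neighbourhood H V"
    and W: "openin T W" "H \<subseteq> W"
  obtains V' where "tame_neighbourhood H V'" "V' \<subseteq> W" "quintuple V' \<subseteq> V"
proof -
  have V0: "openin T (V \<inter> W)" "H \<subseteq> V \<inter> W" using V W by (auto simp: tame_neighbourhood_def)
  obtain A where A: "openin T A" "H \<subseteq> A" "A <#> A \<subseteq> V \<inter> W"
    using open_subgroup_neighbourhood_square[OF H V0] by blast
  obtain B where B: "openin T B" "H \<subseteq> B" "B <#> B \<subseteq> A"
    using open_subgroup_neighbourhood_square[OF H A(1,2)] by blast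
  obtain C where C: "openin T C" "H \<subseteq> C" "C <#> C \<subseteq> B"
    using open_subgroup_neighbourhood_square[OF H B(1,2)] by blast
  define V' where "V' = C \<inter> {x \<in> carrier G. inv x \<in> C}"
  have one: "\<one> \<in> H" using subgroup.one_closed[OF H(1)] .
  have carr: "A \<subseteq> carrier G" "B \<subseteq> carrier G" "C \<subseteq> carrier G" "V' \<subseteq> carrier G"
    using open_subset_carrier A B C by (auto simp: V'_def)
  have "V' \<subseteq> C" by (auto simp: V'_def)
  have "C \<subseteq> B" using set_mult_subset_left[of C C] one C carr by blast
  have "B \<subseteq> A" using set_mult_subset_left[of B B] one B carr by blast
  have "A \<subseteq> V \<inter> W" using set_mult_subset_left[of A A] one A carr by blast
  have sub: "V' \<subseteq> V \<inter> W" using \<open>V' \<subseteq> C\<close> \<open>C \<subseteq> B\<close> \<open>B \<subseteq> A\<close> \<open>A \<subseteq> V \<inter> W\<close> by blast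
  have tame: "tame_neighbourhood H V'"
    unfolding tame_neighbourhood_def
  proof (intro conjI ballI)
    show "openin T V'" unfolding V'_def using C openin_inverse_set by blast
    show "H \<subseteq> V'"
      using C(2) subgroup.m_inv_closed[OF H(1)] subgroup.subset[OF H(1)] by (auto simp: V'_def)
    show "inv x \<in> V'" if "x \<in> V'" for x using that carr by (auto simp: V'_def)
    show "\<exists>K. compactin T K \<and> V' \<subseteq> K" using V sub unfolding tame_neighbourhood_def by (meson le_inf_iff order_trans)
  qed
  have "a \<otimes> b \<otimes> c \<otimes> d \<otimes> e \<in> V" if "a \<in> V'" "b \<in> V'" "c \<in> V'" "d \<in> V'" "e \<in> V'" for a b c d e
  proof -
    have "a \<otimes> b \<in> B" "c \<otimes> d \<in> B"
      using that \<open>V' \<subseteq> C\<close> C(3) by (auto simp: set_mult_subset_iff)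
    then have "(a \<otimes> b) \<otimes> (c \<otimes> d) \<in> A" using B(3) by (auto simp: set_mult_subset_iff)
    moreover have "e \<in> A" using that(5) \<open>V' \<subseteq> C\<close> \<open>C \<subseteq> B\<close> \<open>B \<subseteq> A\<close> by blast
    ultimately have "(a \<otimes> b) \<otimes> (c \<otimes> d) \<otimes> e \<in> V" using A(3) by (auto simp: set_mult_subset_iff)
    moreover have "a \<in> carrier G" "b \<in> carrier G" "c \<in> carrier G" "d \<in> carrier G" "e \<in> carrier G"
      using that carr by auto
    ultimately show ?thesis by (simp add: m_assoc)
  qed
  then have "quintuple V' \<subseteq> V" unfolding quintuple_def by (auto simp: set_mult_def)
  with tame sub show ?thesis by (intro that) auto
qed

lemma larger_tame_neighbourhood:
  assumes lc: "locally_compact_space T" and met: "metrizable_space T"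
    and K: "compactin T K" "H \<subseteq> K"
  obtains V where "tame_neighbourhood H V" "K \<subseteq> V"
proof -
  have "regular_space T" using metrizable_imp_regular_space met .
  then obtain U L where UL: "openin T U" "compactin T L" "K \<subseteq> U" "U \<subseteq> L"
    using locally_compact_space_compact_closed_compact[of T] lc K(1) by blast
  define V where "V = U \<union> {x \<in> carrier G. inv x \<in> U}"
  have "U \<subseteq> carrier G" using UL open_subset_carrier by blast
  show ?thesis
  proof (rule that)
    show "K \<subseteq> V" using UL by (auto simp: V_def)
    have "compactin T ((\<lambda>x. inv x) ` L)" using image_compactin[OF UL(2) continuous_inv] .
    moreover have "V \<subseteq> L \<union> (\<lambda>x. inv x) ` L" using UL(4) by (force simp: V_def)
    ultimately have "\<exists>K. compactin T K \<and> V \<subseteq> K" using UL(2) compactin_Un by blast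
    then show "tame_neighbourhood H V"
      using UL K \<open>U \<subseteq> carrier G\<close> openin_inverse_set
      by (auto simp: tame_neighbourhood_def V_def)
  qed
qed

lemma enlarged_tame_neighbourhood:
  assumes lc: "locally_compact_space T" and met: "metrizable_space T"
    and V: "tame_neighbourhood H V" "\<one> \<in> H" and x: "x \<in> carrier G"
  obtains V' where "tame_neighbourhood H V'" "quintuple V \<subseteq> V'" "x \<in> V'"
proof -
  obtain K where K: "compactin T K" "V \<subseteq> K" using V by (auto simp: tame_neighbourhood_def)
  let ?K = "insert x (quintuple K)"
  have 1: "compactin T (quintuple K)" unfolding quintuple_def using K by (intro compactin_set_mult)
  have "compactin T {x}" using x by (simp add: topspace_eq_carrier)
  then have 2: "compactin T ?K" using compactin_Un[OF _ 1, of "{x}"] by simp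
  have "K \<subseteq> carrier G" using K compact_subset_carrier by blast
  have "\<one> \<in> K" using V K by (auto simp: tame_neighbourhood_def)
  have "K \<subseteq> quintuple K" unfolding quintuple_def
    using set_mult_subset_left[OF \<open>\<one> \<in> K\<close>] \<open>K \<subseteq> carrier G\<close> set_mult_closed by (meson order_trans)
  then have "H \<subseteq> ?K" using V K by (auto simp: tame_neighbourhood_def)
  then obtain V' where V': "tame_neighbourhood H V'" "?K \<subseteq> V'"
    using larger_tame_neighbourhood[OF lc met 2] by blast
  moreover have "quintuple V \<subseteq> quintuple K"
    unfolding quintuple_def using K(2) by (intro mono_set_mult)
  ultimately show ?thesis by (intro that[of V']) auto
qed

text \<open>A compact set in a metric space has the tubes of radius \<open>1 / (k + 1)\<close> as a neighbourhood base, because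
a single radius works at all of its points, by Lebesgue's covering lemma applied to one open set.\<close>

lemma compact_set_neighbourhood_base:
  assumes met: "metrizable_space T" and H: "compactin T H"
  obtains W :: "nat \<Rightarrow> 'g set"
  where "\<And>k. openin T (W k)" "\<And>k. H \<subseteq> W k" "\<And>U. openin T U \<Longrightarrow> H \<subseteq> U \<Longrightarrow> \<exists>k. W k \<subseteq> U"
proof -
  obtain M d where Md: "Metric_space M d" "T = Metric_space.mtopology M d"
    using met by (auto simp: metrizable_space_def)
  interpret Metric_space M d by fact
  have T: "T = mtopology" using Md by simp
  have HM: "H \<subseteq> M" using compactin_subset_topspace[OF H] by (simp add: T)
  define W where "W k = (\<Union>h\<in>H. mball h (inverse (Suc k)))" for k
  show ?thesis
  proof (rule that)
    show "openin T (W k)" for k unfolding W_def T by auto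
    show "H \<subseteq> W k" for k using HM unfolding W_def by force
    fix U assume U: "openin T U" "H \<subseteq> U"
    then obtain e where e: "e > 0" "\<And>x. x \<in> H \<Longrightarrow> mball x e \<subseteq> U"
      using lebesgue_number[of H "{U}"] H by (auto simp: T)
    obtain k where "inverse (Suc k) < e" using reals_Archimedean e(1) by blast
    then have "W k \<subseteq> U" unfolding W_def using e(2) by fastforce
    then show "\<exists>k. W k \<subseteq> U" ..
  qed
qed

text \<open>Downwards, the neighbourhoods are squeezed into a countable base at \<open>H\<close>. Upwards, each one swallows
the quintuple product of the previous one and the next point \<open>q k\<close> of a dense sequence. Both sequences
start from one neighbourhood \<open>V0\<close>. The union is everything because each \<open>x\<close> differs from some
\<open>q k\<close> by an element of \<open>V0\<close>.\<close>

lemma tame_filtration: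
  assumes lc: "locally_compact_space T" and met: "metrizable_space T" and sep: "separable_space T"
    and H: "subgroup H G" "compactin T H"
  obtains V :: "int \<Rightarrow> 'g set" where
    "\<And>n. tame_neighbourhood H (V n)" "\<And>n. quintuple (V n) \<subseteq> V (n + 1)"
    "\<And>U. openin T U \<Longrightarrow> H \<subseteq> U \<Longrightarrow> \<exists>n. V n \<subseteq> U" "(\<Union>n. V n) = carrier G"
proof -
  have one: "\<one> \<in> H" using subgroup.one_closed[OF H(1)] .
  obtain V0 where V0: "tame_neighbourhood H V0"
    using larger_tame_neighbourhood[OF lc met H(2) order_refl] by blast
  obtain W :: "nat \<Rightarrow> 'g set" where W: "\<And>k. openin T (W k)" "\<And>k. H \<subseteq> W k"
    "\<And>U. openin T U \<Longrightarrow> H \<subseteq> U \<Longrightarrow> \<exists>k. W k \<subseteq> U"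
    using compact_set_neighbourhood_base[OF met H(2)] by blast
  obtain C where C: "countable C" "C \<subseteq> carrier G" "T closure_of C = carrier G"
    using sep by (auto simp: separable_space_def topspace_eq_carrier)
  then have "C \<noteq> {}" using one_closed by fastforce
  define q where "q = from_nat_into C"
  have q: "range q = C" unfolding q_def using \<open>C \<noteq> {}\<close> C(1) by (rule range_from_nat_into)
  have "\<exists>A. \<forall>k. (tame_neighbourhood H (A k) \<and> (k = 0 \<longrightarrow> A k = V0)) \<and>
      A (Suc k) \<subseteq> W k \<and> quintuple (A (Suc k)) \<subseteq> A k"
  proof (rule dependent_nat_choice)
    show "\<exists>V. tame_neighbourhood H V \<and> (0 = 0 \<longrightarrow> V = V0)" using V0 by blast
    fix V and k :: nat assume V: "tame_neighbourhood H V \<and> (k = 0 \<longrightarrow> V = V0)"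
    obtain V' where "tame_neighbourhood H V'" "V' \<subseteq> W k" "quintuple V' \<subseteq> V"
      using smaller_tame_neighbourhood[OF H _ W(1,2)] V by blast
    then show "\<exists>V'. (tame_neighbourhood H V' \<and> (Suc k = 0 \<longrightarrow> V' = V0)) \<and>
        V' \<subseteq> W k \<and> quintuple V' \<subseteq> V" by blast
  qed
  then obtain A where A: "\<And>k. tame_neighbourhood H (A k)" "A 0 = V0"
    "\<And>k. A (Suc k) \<subseteq> W k" "\<And>k. quintuple (A (Suc k)) \<subseteq> A k" by blast
  have "\<exists>B. \<forall>k. (tame_neighbourhood H (B k) \<and> (k = 0 \<longrightarrow> B k = V0)) \<and>
      quintuple (B k) \<subseteq> B (Suc k) \<and> q k \<in> B (Suc k)"
  proof (rule dependent_nat_choice)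
    show "\<exists>V. tame_neighbourhood H V \<and> (0 = 0 \<longrightarrow> V = V0)" using V0 by blast
    fix V and k :: nat assume V: "tame_neighbourhood H V \<and> (k = 0 \<longrightarrow> V = V0)"
    have "q k \<in> carrier G" using q C by auto
    then obtain V' where "tame_neighbourhood H V'" "quintuple V \<subseteq> V'" "q k \<in> V'"
      using enlarged_tame_neighbourhood[OF lc met _ one] V by blast
    then show "\<exists>V'. (tame_neighbourhood H V' \<and> (Suc k = 0 \<longrightarrow> V' = V0)) \<and>
        quintuple V \<subseteq> V' \<and> q k \<in> V'" by blast
  qed
  then obtain B where B: "\<And>k. tame_neighbourhood H (B k)" "B 0 = V0"
    "\<And>k. quintuple (B k) \<subseteq> B (Suc k)" "\<And>k. q k \<in> B (Suc k)" by blast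
  define V where "V n = (if 0 \<le> n then B (nat n) else A (nat (- n)))" for n
  have V: "tame_neighbourhood H (V n)" for n by (simp add: V_def A B)
  have step: "quintuple (V n) \<subseteq> V (n + 1)" for n
  proof (cases "0 \<le> n")
    case True
    then show ?thesis using B(3)[of "nat n"] by (simp add: V_def nat_add_distrib)
  next
    case False
    define k where "k = nat (- n - 1)"
    have k: "n = - int (Suc k)" using False by (simp add: k_def)
    have "V n = A (Suc k)" by (simp add: V_def k nat_add_distrib)
    moreover have "V (n + 1) = A k" using A(2) B(2) by (simp add: V_def k)
    ultimately show ?thesis using A(4)[of k] by simp
  qed
  have sub: "V n \<subseteq> carrier G" for n
    using V open_subset_carrier by (auto simp: tame_neighbourhood_def)
  have q5: "V n <#> V n \<subseteq> quintuple (V n)" for n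
  proof -
    have 1: "\<one> \<in> V n" using V one by (auto simp: tame_neighbourhood_def)
    show ?thesis unfolding quintuple_def
      using set_mult_subset_left[OF 1] sub set_mult_closed by (meson order_trans)
  qed
  have mono: "V n \<subseteq> V (n + int k)" for n k
  proof (induction k)
    case (Suc k)
    have "\<one> \<in> V (n + int k)" using V one by (auto simp: tame_neighbourhood_def)
    then have "V (n + int k) \<subseteq> V (n + int k + 1)"
      using set_mult_subset_left sub q5 step by (meson order_trans)
    with Suc show ?case by (simp add: algebra_simps)
  qed simp
  show ?thesis
  proof (rule that[of V, OF V step])
    fix U assume "openin T U" "H \<subseteq> U"
    then obtain k where "W k \<subseteq> U" using W(3) by blast
    then have "V (- int (Suc k)) \<subseteq> U" using A(3)[of k] by (simp add: V_def nat_add_distrib)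
    then show "\<exists>n. V n \<subseteq> U" ..
  next
    show "(\<Union>n. V n) = carrier G"
    proof (intro subset_antisym subsetI)
      fix x assume x: "x \<in> carrier G"
      let ?U = "{y \<in> carrier G. inv x \<otimes> y \<in> V 0}"
      have "x \<in> T closure_of C" using C(3) x by simp
      then have cl: "\<exists>y\<in>C. y \<in> U" if "openin T U" "x \<in> U" for U
        using that unfolding in_closure_of by blast
      have "openin T ?U" using openin_left_translation[of "inv x"] x V[of 0]
        by (auto simp: tame_neighbourhood_def)
      moreover have "x \<in> ?U" using x V[of 0] one by (auto simp: tame_neighbourhood_def)
      ultimately obtain y where y: "y \<in> C" "y \<in> ?U"
        using cl[of ?U] by blast
      have yG: "y \<in> carrier G" using y by simp
      have "inv (inv x \<otimes> y) \<in> V 0" using y V[of 0] by (auto simp: tame_neighbourhood_def)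
      then have z: "inv y \<otimes> x \<in> V 0" using x yG by (simp add: inv_mult_group)
      obtain k where k: "y = q k" using y q by auto
      then have "y \<in> V (int (Suc k))" using B(4)[of k] by (simp add: V_def nat_add_distrib)
      moreover have "inv y \<otimes> x \<in> V (int (Suc k))" using z mono[of 0 "Suc k"] by auto
      ultimately have "y \<otimes> (inv y \<otimes> x) \<in> V (int (Suc k)) <#> V (int (Suc k))"
        by (rule set_multI)
      moreover have "y \<otimes> (inv y \<otimes> x) = x" using yG x by (rule mult_inv_cancel)
      ultimately have "x \<in> V (int (Suc k) + 1)"
        using q5[of "int (Suc k)"] step[of "int (Suc k)"] by auto
      then show "x \<in> (\<Union>n. V n)" by blast
    qed (use sub in blast)
  qed
qed

end


section \<open>Invariant proper metrics on quotients by compact subgroups\<close>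

text \<open>Two points are related at scale \<open>n\<close> if they have representatives \<open>x\<close>, \<open>y\<close> with
\<open>inv x \<otimes> y \<in> V n\<close>. This condition is invariant under left translation, so the group acts by isometries
of the chain metric. The neighbourhoods \<open>V n\<close> form a base at \<open>H\<close> for \<open>n \<rightarrow> -\<infinity>\<close>, which
gives the quotient topology, and they are relatively compact and exhaust the group for \<open>n \<rightarrow> \<infinity>\<close>, which makes
the metric proper. The quotient enters only through the map \<open>\<pi>\<close> and its fibres, so \<open>X\<close> need not
consist of cosets.\<close>

lemma (in topological_group) metrically_homogeneous_compact_quotient:
  assumes lc: "locally_compact_space T" and met: "metrizable_space T" and sep: "separable_space T"
    and H: "subgroup H G" "compactin T H"
    and \<pi>: "quotient_map T X \<pi>"
    and fibres: "\<And>x y. x \<in> carrier G \<Longrightarrow> y \<in> carrier G \<Longrightarrow> \<pi> x = \<pi> y \<longleftrightarrow> inv x \<otimes> y \<in> H"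
  shows "metrically_homogeneous_proper X"
proof -
  define M where "M = topspace X"
  have \<pi>M: "\<pi> ` carrier G = M"
    using quotient_imp_surjective_map[OF \<pi>] by (simp add: M_def topspace_eq_carrier)
  obtain V :: "int \<Rightarrow> 'g set" where V: "\<And>n. tame_neighbourhood H (V n)"
    and V5: "\<And>n. quintuple (V n) \<subseteq> V (n + 1)"
    and V_base: "\<And>U. openin T U \<Longrightarrow> H \<subseteq> U \<Longrightarrow> \<exists>n. V n \<subseteq> U" and V_Un: "(\<Union>n. V n) = carrier G"
    using tame_filtration[OF lc met sep H] by blast
  have V_open: "openin T (V n)" and HV: "H \<subseteq> V n" and V_inv: "x \<in> V n \<Longrightarrow> inv x \<in> V n" for n x
    using V[of n] by (auto simp: tame_neighbourhood_def)
  have V_carr: "x \<in> carrier G" if "x \<in> V n" for x n using that V_Un by blast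
  have oneV: "\<one> \<in> V n" for n using HV subgroup.one_closed[OF H(1)] by blast
  have five: "a \<otimes> b \<otimes> c \<otimes> d \<otimes> e \<in> V (n + 1)"
    if "a \<in> V n" "b \<in> V n" "c \<in> V n" "d \<in> V n" "e \<in> V n" for a b c d e n
    by (rule subsetD[OF V5]) (unfold quintuple_def, intro set_multI that)
  have two: "a \<otimes> b \<in> V (n + 1)" if "a \<in> V n" "b \<in> V n" for a b n
    using five[OF that oneV oneV oneV] that[THEN V_carr] by simp
  have three: "a \<otimes> b \<otimes> c \<in> V (n + 1)" if "a \<in> V n" "b \<in> V n" "c \<in> V n" for a b c n
    using five[OF that oneV oneV] that[THEN V_carr] by simp
  define E where "E n = {(\<pi> x, \<pi> y) | x y. x \<in> carrier G \<and> y \<in> carrier G \<and> inv x \<otimes> y \<in> V n}" for n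
  have E_I: "(\<pi> x, \<pi> y) \<in> E n" if "x \<in> carrier G" "y \<in> carrier G" "inv x \<otimes> y \<in> V n" for x y n
    unfolding E_def using that by blast
  \<comment> \<open>An arbitrary representative \<open>x\<close> may differ from the one that witnesses the relation, at the cost of one factor from \<open>H \<subseteq> V n\<close>.\<close>
  have E_D: "\<exists>h\<in>V n. \<exists>v\<in>V n. \<exists>y\<in>carrier G. q = \<pi> y \<and> inv x \<otimes> y = h \<otimes> v"
    if pq: "(\<pi> x, q) \<in> E n" and x: "x \<in> carrier G" for x q n
  proof -
    from pq obtain a y where *: "a \<in> carrier G" "y \<in> carrier G" "inv a \<otimes> y \<in> V n" "\<pi> x = \<pi> a" "q = \<pi> y"
      by (auto simp: E_def)
    have "inv x \<otimes> a \<in> V n" using fibres[of x a] * x HV by blast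
    moreover have "inv x \<otimes> y = (inv x \<otimes> a) \<otimes> (inv a \<otimes> y)"
      using * x by (simp add: telescope_inv_mult)
    ultimately show ?thesis using * by blast
  qed
  have E_D1: "\<exists>y\<in>carrier G. q = \<pi> y \<and> inv x \<otimes> y \<in> V (n + 1)"
    if "(\<pi> x, q) \<in> E n" "x \<in> carrier G" for x q n
    using E_D[OF that] two by metis
  have E_D2: "inv x \<otimes> y \<in> V (n + 1)"
    if xy: "(\<pi> x, \<pi> y) \<in> E n" "x \<in> carrier G" "y \<in> carrier G" for x y n
  proof -
    obtain h v z where *: "h \<in> V n" "v \<in> V n" "z \<in> carrier G" "\<pi> y = \<pi> z" "inv x \<otimes> z = h \<otimes> v"
      using E_D[OF xy(1,2)] by blast
    have "inv z \<otimes> y \<in> V n" using fibres[of z y] * xy HV by auto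
    moreover have "inv x \<otimes> y = (inv x \<otimes> z) \<otimes> (inv z \<otimes> y)"
      using *(3) xy(2,3) by (simp add: telescope_inv_mult)
    ultimately show ?thesis using three * by simp
  qed
  interpret metric_scales M E
  proof
    show "E n \<subseteq> M \<times> M" for n using \<pi>M by (auto simp: E_def)
    show "(p, p) \<in> E n" if "p \<in> M" for p n
    proof -
      obtain x where "x \<in> carrier G" "p = \<pi> x" using \<open>p \<in> M\<close> \<pi>M by blast
      then show ?thesis using E_I[of x x n] oneV by simp
    qed
    show "(q, p) \<in> E n" if "(p, q) \<in> E n" for p q n
    proof -
      from that obtain x y where *: "x \<in> carrier G" "y \<in> carrier G" "inv x \<otimes> y \<in> V n" "p = \<pi> x" "q = \<pi> y"
        by (auto simp: E_def)
      then have "inv y \<otimes> x \<in> V n" using V_inv[OF *(3)] by (simp add: inv_mult_group)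
      then show ?thesis using E_I * by simp
    qed
    show "E n O E n O E n \<subseteq> E (n + 1)" for n
    proof clarify
      fix p q r s assume pqrs: "(p, q) \<in> E n" "(q, r) \<in> E n" "(r, s) \<in> E n"
      obtain x y where xy: "x \<in> carrier G" "y \<in> carrier G" "inv x \<otimes> y \<in> V n" "p = \<pi> x" "q = \<pi> y"
        using pqrs(1) by (auto simp: E_def)
      obtain g u z where z: "g \<in> V n" "u \<in> V n" "z \<in> carrier G" "r = \<pi> z" "inv y \<otimes> z = g \<otimes> u"
        using E_D[of y r n] pqrs xy by blast
      obtain h v w where w: "h \<in> V n" "v \<in> V n" "w \<in> carrier G" "s = \<pi> w" "inv z \<otimes> w = h \<otimes> v"
        using E_D[of z s n] pqrs z by blast
      have "inv x \<otimes> w = (inv x \<otimes> y) \<otimes> (inv y \<otimes> z) \<otimes> (inv z \<otimes> w)"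
        using xy(1,2) z(3) w(3) by (simp add: telescope_inv_mult)
      also have "\<dots> = (inv x \<otimes> y) \<otimes> g \<otimes> u \<otimes> h \<otimes> v"
        using xy z w V_carr by (simp add: m_assoc)
      also have "\<dots> \<in> V (n + 1)" using five xy z w by blast
      finally show "(p, s) \<in> E (n + 1)" using E_I xy w by simp
    qed
    show "p = q" if pq: "\<And>n. (p, q) \<in> E n" for p q
    proof (rule ccontr)
      assume "p \<noteq> q"
      obtain x y where xy: "x \<in> carrier G" "y \<in> carrier G" "p = \<pi> x" "q = \<pi> y"
        using pq[of 0] by (auto simp: E_def)
      have all: "inv x \<otimes> y \<in> V n" for n using E_D2[of x y "n - 1"] pq xy by simp
      have "inv x \<otimes> y \<notin> H" using \<open>p \<noteq> q\<close> fibres[of x y] xy by simp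
      moreover have "closedin T {inv x \<otimes> y}"
        using t1_space_closedin_singleton[of T] metrizable_imp_t1_space[OF met] xy topspace_eq_carrier
        by simp
      ultimately have "openin T (carrier G - {inv x \<otimes> y})" "H \<subseteq> carrier G - {inv x \<otimes> y}"
        using subgroup.subset[OF H(1)] topspace_eq_carrier by (auto simp: closedin_def)
      then obtain n where "V n \<subseteq> carrier G - {inv x \<otimes> y}" using V_base by blast
      with all show False by blast
    qed
    show "\<exists>n. (p, q) \<in> E n" if pq: "p \<in> M" "q \<in> M" for p q
    proof -
      obtain x y where xy: "x \<in> carrier G" "y \<in> carrier G" "p = \<pi> x" "q = \<pi> y"
        using pq \<pi>M by blast
      then have "inv x \<otimes> y \<in> (\<Union>n. V n)" unfolding V_Un by simp
      then show ?thesis using E_I xy by blast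
    qed
  qed
  have mtop: "mtopology = X"
  proof (rule mtopology_scale_dist)
    show "topspace X = M" by (simp add: M_def)
    fix U assume U: "U \<subseteq> M"
    have pre: "openin X U \<longleftrightarrow> openin T {x \<in> carrier G. \<pi> x \<in> U}"
      using \<pi> U by (simp add: quotient_map_def M_def topspace_eq_carrier)
    show "openin X U \<longleftrightarrow> (\<forall>p\<in>U. \<exists>n. E n `` {p} \<subseteq> U)"
    proof (intro iffI ballI)
      fix p assume O: "openin X U" and p: "p \<in> U"
      obtain x where x: "x \<in> carrier G" "p = \<pi> x" using p U \<pi>M by blast
      let ?W = "{y \<in> carrier G. x \<otimes> y \<in> {x \<in> carrier G. \<pi> x \<in> U}}"
      have "openin T ?W" using openin_left_translation[OF x(1)] O pre by blast
      moreover have "H \<subseteq> ?W"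
      proof
        fix h assume h: "h \<in> H"
        then have hG: "h \<in> carrier G" using subgroup.subset[OF H(1)] by blast
        have "inv x \<otimes> (x \<otimes> h) = h" using x hG inv_mult_cancel by blast
        then have "\<pi> x = \<pi> (x \<otimes> h)" using fibres[of x "x \<otimes> h"] x hG h by simp
        then show "h \<in> ?W" using p x hG by simp
      qed
      ultimately obtain n where n: "V n \<subseteq> ?W" using V_base by blast
      have "E (n - 1) `` {p} \<subseteq> U"
      proof
        fix q assume "q \<in> E (n - 1) `` {p}"
        then obtain y where y: "y \<in> carrier G" "q = \<pi> y" "inv x \<otimes> y \<in> V n"
          using E_D1[of x q "n - 1"] x by auto
        have "x \<otimes> (inv x \<otimes> y) = y" using x y mult_inv_cancel by simp
        then show "q \<in> U" using n y by fastforce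
      qed
      then show "\<exists>n. E n `` {p} \<subseteq> U" ..
    next
      assume *: "\<forall>p\<in>U. \<exists>n. E n `` {p} \<subseteq> U"
      have "\<exists>S. openin T S \<and> x \<in> S \<and> S \<subseteq> {x \<in> carrier G. \<pi> x \<in> U}"
        if x: "x \<in> {x \<in> carrier G. \<pi> x \<in> U}" for x
      proof -
        from x * obtain n where n: "E n `` {\<pi> x} \<subseteq> U" by blast
        let ?S = "{y \<in> carrier G. inv x \<otimes> y \<in> V n}"
        have "openin T ?S" using openin_left_translation[OF _ V_open] x by simp
        moreover have "x \<in> ?S" using x oneV by simp
        moreover have "?S \<subseteq> {x \<in> carrier G. \<pi> x \<in> U}" using E_I x n by blast
        ultimately show ?thesis by blast
      qed
      then have "openin T {x \<in> carrier G. \<pi> x \<in> U}" by (subst openin_subopen) blast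
      then show "openin X U" using pre by simp
    qed
  qed
  have proper: "proper_metric"
  proof (rule proper_metric_scale_dist)
    fix p n assume "p \<in> M"
    then obtain x where x: "x \<in> carrier G" "p = \<pi> x" using \<pi>M by blast
    obtain K where K: "compactin T K" "V (n + 1) \<subseteq> K"
      using V[of "n + 1"] unfolding tame_neighbourhood_def by blast
    let ?K = "\<pi> ` (\<lambda>y. x \<otimes> y) ` K"
    have "compactin X ?K"
      using image_compactin[OF compactin_left_translate[OF x(1) K(1)]] \<pi> quotient_imp_continuous_map
      by blast
    moreover have "E n `` {p} \<subseteq> ?K"
    proof
      fix q assume "q \<in> E n `` {p}"
      then obtain y where y: "y \<in> carrier G" "q = \<pi> y" "inv x \<otimes> y \<in> V (n + 1)"
        using E_D1[of x q n] x by auto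
      have "y = x \<otimes> (inv x \<otimes> y)" using x y mult_inv_cancel by simp
      then show "q \<in> ?K" using y K by blast
    qed
    ultimately show "\<exists>K. compactin mtopology K \<and> E n `` {p} \<subseteq> K" unfolding mtop by blast
  qed
  \<comment> \<open>The left translations on the quotient, computed through chosen representatives.\<close>
  define s where "s p = (SOME x. x \<in> carrier G \<and> \<pi> x = p)" for p
  have s: "s p \<in> carrier G" "\<pi> (s p) = p" if "p \<in> M" for p
  proof -
    have "\<exists>x. x \<in> carrier G \<and> \<pi> x = p" using that \<pi>M by blast
    from someI_ex[OF this] show "s p \<in> carrier G" "\<pi> (s p) = p" by (simp_all add: s_def)
  qed
  define \<psi> where "\<psi> g = (\<lambda>p\<in>M. \<pi> (g \<otimes> s p))" for g
  have cancel: "inv (g \<otimes> x) \<otimes> (g \<otimes> y) = inv x \<otimes> y"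
    if "g \<in> carrier G" "x \<in> carrier G" "y \<in> carrier G" for g x y
    using that by (simp add: inv_mult_group m_assoc inv_mult_cancel)
  have \<psi>: "\<psi> g (\<pi> x) = \<pi> (g \<otimes> x)" if g: "g \<in> carrier G" and x: "x \<in> carrier G" for g x
  proof -
    have M: "\<pi> x \<in> M" using x \<pi>M by blast
    have "inv (s (\<pi> x)) \<otimes> x \<in> H" using fibres[of "s (\<pi> x)" x] s[OF M] x by simp
    then have "\<pi> (g \<otimes> s (\<pi> x)) = \<pi> (g \<otimes> x)"
      using fibres[of "g \<otimes> s (\<pi> x)" "g \<otimes> x"] s[OF M] x g cancel by simp
    then show ?thesis using M by (simp add: \<psi>_def)
  qed
  have \<psi>M: "\<psi> g p \<in> M" if g: "g \<in> carrier G" and p: "p \<in> M" for g p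
    using that s[OF p] \<pi>M by (auto simp: \<psi>_def)
  have \<psi>inv: "\<psi> (inv g) (\<psi> g p) = p" if g: "g \<in> carrier G" and p: "p \<in> M" for g p
  proof -
    obtain x where x: "x \<in> carrier G" "p = \<pi> x" using p \<pi>M by blast
    have "inv g \<otimes> (g \<otimes> x) = x" using g x inv_mult_cancel by blast
    then show ?thesis using g x by (simp add: \<psi>)
  qed
  have \<psi>E: "(\<psi> g p, \<psi> g q) \<in> E n" if pq: "(p, q) \<in> E n" and g: "g \<in> carrier G" for g p q n
  proof -
    obtain x y where "x \<in> carrier G" "y \<in> carrier G" "inv x \<otimes> y \<in> V n" "p = \<pi> x" "q = \<pi> y"
      using pq by (auto simp: E_def)
    then show ?thesis using E_I[of "g \<otimes> x" "g \<otimes> y" n] g by (simp add: \<psi> cancel)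
  qed
  have iso: "\<psi> g \<in> carrier isometry_group" if g: "g \<in> carrier G" for g
  proof -
    have bij: "bij_betw (\<psi> g) M M"
      by (rule bij_betw_byWitness[where f' = "\<psi> (inv g)"])
        (use g \<psi>M \<psi>inv[of g] \<psi>inv[of "inv g"] in auto)
    have "(\<psi> g p, \<psi> g q) \<in> E n \<longleftrightarrow> (p, q) \<in> E n" if "p \<in> M" "q \<in> M" for p q n
      using \<psi>E[of p q n g] \<psi>E[of "\<psi> g p" "\<psi> g q" n "inv g"] \<psi>inv that g by auto
    then have "scale_dist (\<psi> g p) (\<psi> g q) = scale_dist p q" if "p \<in> M" "q \<in> M" for p q
      using scale_dist_isometry[OF bij] that by blast
    then show ?thesis using bij by (simp add: isometry_group_def Bij_def \<psi>_def)
  qed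
  have "\<exists>f\<in>carrier isometry_group. f p = q" if pq: "p \<in> M" "q \<in> M" for p q
  proof -
    obtain x y where xy: "x \<in> carrier G" "y \<in> carrier G" "p = \<pi> x" "q = \<pi> y"
      using pq \<pi>M by blast
    have "\<psi> (y \<otimes> inv x) p = q" using xy by (simp add: \<psi> m_assoc)
    then show ?thesis using iso[of "y \<otimes> inv x"] xy by blast
  qed
  then have "transitive_action isometry_group M (\<lambda>f. f)" by (simp add: transitive_isometry_group_iff)
  then show ?thesis
    unfolding metrically_homogeneous_proper_def M_def[symmetric]
    using Metric_space_axioms mtop proper by blast
qed

text \<open>The subgroup stabilizes the base coset, so the fibre of the perfect map \<open>(g, C) \<mapsto> (gC, C)\<close> over
\<open>(H, H)\<close> is \<open>H \<times> {H}\<close>.\<close>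

lemma (in topological_group) compactin_proper_coset_stabilizer:
  assumes H: "subgroup H G"
    and proper: "proper_action G T (coset_topology G T H) (coset_action G H)"
  shows "compactin T H"
proof -
  let ?Y = "coset_topology G T H"
  let ?f = "\<lambda>(g, C). (coset_action G H g C, C)"
  have sub: "H \<subseteq> carrier G" using subgroup.subset[OF H] .
  have H_coset: "\<one> <#\<^bsub>G\<^esub> H = H" using sub by (rule lcos_mult_one)
  then have "H \<in> lcosets H" unfolding LCOSETS_def by blast
  then have HY: "H \<in> topspace ?Y" by (simp add: topspace_coset_topology topspace_eq_carrier)
  have "compactin (prod_topology T ?Y) {p \<in> topspace (prod_topology T ?Y). ?f p = (H, H)}"
    using proper HY unfolding proper_action_def proper_map_def by auto
  then have "compactin T (fst ` {p \<in> topspace (prod_topology T ?Y). ?f p = (H, H)})"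
    by (rule image_compactin[OF _ continuous_map_fst])
  moreover have "coset_action G H g H = H \<longleftrightarrow> g \<in> H" if "g \<in> carrier G" for g
  proof -
    have "coset_action G H g H = g <#\<^bsub>G\<^esub> H"
      using coset_action_coset[OF sub that one_closed] that H_coset by simp
    moreover have "g <#\<^bsub>G\<^esub> H = H \<longleftrightarrow> g \<in> H"
      using l_coset_eq_iff[OF H one_closed that] H_coset that by (simp add: eq_commute)
    ultimately show ?thesis by simp
  qed
  then have "fst ` {p \<in> topspace (prod_topology T ?Y). ?f p = (H, H)} = H"
    using sub HY by (force simp: topspace_eq_carrier)
  ultimately show ?thesis by simp
qed

theorem proper_coset_space_imp_metrically_homogeneous:
  assumes "proper_coset_space G T H X"
  shows "metrically_homogeneous_proper X"
proof -
  interpret topological_group G T using assms by (simp add: proper_coset_space_def)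
  let ?Y = "coset_topology G T H"
  have H: "subgroup H G" and lc: "locally_compact_space T" and sep: "separable_space T"
    and met: "metrizable_space T" and act: "proper_action G T ?Y (coset_action G H)"
    using assms by (auto simp: proper_coset_space_def)
  have "?Y homeomorphic_space X"
    using assms homeomorphic_space_sym by (auto simp: proper_coset_space_def)
  then obtain k where k: "homeomorphic_map ?Y X k" by (auto simp: homeomorphic_space)
  have "quotient_map T X (k \<circ> (\<lambda>x. x <#\<^bsub>G\<^esub> H))"
    using quotient_map_compose[OF quotient_map_coset_topology k[unfolded homeomorphic_map_def, THEN conjunct1]]
      topspace_eq_carrier by blast
  moreover have "(k \<circ> (\<lambda>x. x <#\<^bsub>G\<^esub> H)) x = (k \<circ> (\<lambda>x. x <#\<^bsub>G\<^esub> H)) y \<longleftrightarrow> inv\<^bsub>G\<^esub> x \<otimes>\<^bsub>G\<^esub> y \<in> H"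
    if "x \<in> carrier G" "y \<in> carrier G" for x y
  proof -
    have "x <#\<^bsub>G\<^esub> H \<in> topspace ?Y" "y <#\<^bsub>G\<^esub> H \<in> topspace ?Y"
      using that by (auto simp: topspace_coset_topology topspace_eq_carrier LCOSETS_def)
    then have "k (x <#\<^bsub>G\<^esub> H) = k (y <#\<^bsub>G\<^esub> H) \<longleftrightarrow> x <#\<^bsub>G\<^esub> H = y <#\<^bsub>G\<^esub> H"
      by (rule inj_on_eq_iff[OF homeomorphic_imp_injective_map[OF k]])
    also have "\<dots> \<longleftrightarrow> inv\<^bsub>G\<^esub> x \<otimes>\<^bsub>G\<^esub> y \<in> H" using l_coset_eq_iff[OF H that] .
    finally show ?thesis by simp
  qed
  ultimately show ?thesis
    using metrically_homogeneous_compact_quotient[OF lc met sep H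
        compactin_proper_coset_stabilizer[OF H act]] by blast
qed


section \<open>Pullback topologies, separability and cardinality\<close>

lemma homeomorphic_map_pullback_topology:
  assumes inj: "inj_on f A" and im: "f ` A \<subseteq> topspace S"
  shows "homeomorphic_map (pullback_topology A f S) (subtopology S (f ` A)) f"
proof (rule bijective_open_imp_homeomorphic_map)
  let ?P = "pullback_topology A f S"
  have top: "topspace ?P = A" using im by (auto simp: topspace_pullback_topology)
  have "continuous_map ?P S (id \<circ> f)" by (rule continuous_map_pullback) simp
  then show "continuous_map ?P (subtopology S (f ` A)) f"
    by (auto simp: continuous_map_in_subtopology top)
  show "f ` topspace ?P = topspace (subtopology S (f ` A))" using im top by auto
  show "inj_on f (topspace ?P)" using inj top by simp
  show "open_map ?P (subtopology S (f ` A)) f"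
    unfolding open_map_def
  proof (intro allI impI)
    fix U assume "openin ?P U"
    then obtain W where W: "openin S W" "U = f -` W \<inter> A" by (auto simp: openin_pullback_topology)
    then have "f ` U = W \<inter> f ` A" by auto
    then show "openin (subtopology S (f ` A)) (f ` U)" using W(1) openin_subtopology by blast
  qed
qed

lemma compactin_pullback_topology:
  assumes "inj_on f A" "f ` A \<subseteq> topspace S" "K \<subseteq> A" "compactin S (f ` K)"
  shows "compactin (pullback_topology A f S) K"
proof -
  have top: "topspace (pullback_topology A f S) = A"
    using assms(2) by (auto simp: topspace_pullback_topology)
  have "compactin (subtopology S (f ` A)) (f ` K)"
    using assms(3,4) by (auto simp: compactin_subtopology)
  then show ?thesis
    using homeomorphic_map_compactness[OF homeomorphic_map_pullback_topology[OF assms(1,2)], of K]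
      assms(3) top by simp
qed

text \<open>Compact sets are totally bounded; the union of finite nets of all mesh sizes is a countable dense
set.\<close>

lemma sigma_compact_metrizable_imp_separable:
  fixes C :: "nat \<Rightarrow> 'b set"
  assumes met: "metrizable_space X" and C: "\<And>n. compactin X (C n)" and Un: "topspace X \<subseteq> (\<Union>n. C n)"
  shows "separable_space X"
proof -
  obtain M d where Md: "Metric_space M d" "X = Metric_space.mtopology M d"
    using met by (auto simp: metrizable_space_def)
  interpret Metric_space M d by fact
  have X: "X = mtopology" using Md by simp
  have "\<exists>K. finite K \<and> K \<subseteq> C n \<and> C n \<subseteq> (\<Union>x\<in>K. mball x (inverse (Suc k)))" for n k :: nat
  proof -
    have "mtotally_bounded (C n)" using C[of n] compactin_imp_mtotally_bounded X by simp
    then show ?thesis unfolding mtotally_bounded_def by simp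
  qed
  then obtain N where N: "\<And>n k. finite (N n k)" "\<And>n k. N n k \<subseteq> C n"
    "\<And>n k :: nat. C n \<subseteq> (\<Union>x\<in>N n k. mball x (inverse (Suc k)))" by metis
  define Q where "Q = (\<Union>n. \<Union>k. N n k)"
  have CM: "C n \<subseteq> M" for n using compactin_subset_topspace[OF C[of n]] X by simp
  have "countable Q" unfolding Q_def using N(1) by (intro countable_UN) (auto intro: countable_finite)
  moreover have "Q \<subseteq> M" unfolding Q_def using N(2) CM by fast
  moreover have "mtopology closure_of Q = M"
  proof -
    have "\<exists>y\<in>Q. y \<in> mball x r" if x: "x \<in> M" and r: "r > 0" for x r
    proof -
      obtain n where n: "x \<in> C n" using Un x X by auto
      obtain k where k: "inverse (Suc k) < r" using reals_Archimedean r by blast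
      obtain y where y: "y \<in> N n k" "x \<in> mball y (inverse (Suc k))" using N(3)[of n k] n by auto
      then have "y \<in> mball x r" using k by (auto simp: commute)
      moreover have "y \<in> Q" using y by (auto simp: Q_def)
      ultimately show ?thesis by blast
    qed
    then show ?thesis by (auto simp: metric_closure_of)
  qed
  ultimately show ?thesis unfolding separable_space_def X by auto
qed

text \<open>A point is determined by the set of pairs \<open>(n, k)\<close> for which it lies within \<open>1 / (k + 1)\<close> of the
\<open>n\<close>-th point of a dense sequence.\<close>

lemma separable_metrizable_lepoll_reals:
  assumes "metrizable_space X" "separable_space X"
  shows "topspace X \<lesssim> (UNIV :: real set)"
proof -
  obtain M d where Md: "Metric_space M d" "X = Metric_space.mtopology M d"
    using assms by (auto simp: metrizable_space_def)
  interpret Metric_space M d by fact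
  have X: "X = mtopology" using Md by simp
  obtain C where C: "countable C" "C \<subseteq> M" "mtopology closure_of C = M"
    using assms(2) by (auto simp: separable_space_def X)
  define code where "code x = {q. d x (from_nat_into C (fst (prod_decode q))) < inverse (Suc (snd (prod_decode q)))}" for x
  have "inj_on code M"
  proof
    fix x y assume xy: "x \<in> M" "y \<in> M" "code x = code y"
    show "x = y"
    proof (rule ccontr)
      assume "x \<noteq> y"
      then have "d x y / 2 > 0" using xy by simp
      then obtain k where k: "inverse (Suc k) < d x y / 2" using reals_Archimedean by blast
      have "0 < inverse (real (Suc k))" by simp
      moreover have "x \<in> mtopology closure_of C" using C(3) xy(1) by simp
      ultimately obtain c where "c \<in> C" "c \<in> mball x (inverse (Suc k))"
        unfolding metric_closure_of by blast
      then have c: "c \<in> C" "d x c < inverse (Suc k)" by auto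
      obtain n where n: "from_nat_into C n = c" using from_nat_into_surj[OF C(1) c(1)] by blast
      have "prod_encode (n, k) \<in> code x" using c n by (simp add: code_def)
      then have "prod_encode (n, k) \<in> code y" using xy(3) by simp
      then have "d y c < inverse (Suc k)" by (simp add: code_def n)
      moreover have "d x y \<le> d x c + d c y" using xy c C(2) by (intro triangle) auto
      ultimately show False using c(2) k commute[of c y] by linarith
    qed
  qed
  then have "M \<lesssim> (UNIV :: nat set set)" unfolding lepoll_def by blast
  then have "M \<lesssim> (UNIV :: real set)"
    using nat_sets_eqpoll_reals eqpoll_imp_lepoll lepoll_trans by blast
  then show ?thesis by (simp add: X)
qed

lemma proper_map_cong:
  assumes f: "proper_map X Y f" and eq: "\<And>x. x \<in> topspace X \<Longrightarrow> f x = g x"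
  shows "proper_map X Y g"
proof -
  have "g ` C = f ` C" if "closedin X C" for C
    by (rule image_cong) (use closedin_subset[OF that] eq in auto)
  moreover have "{x \<in> topspace X. g x = y} = {x \<in> topspace X. f x = y}" for y
    using eq by auto
  ultimately show ?thesis using f by (simp add: proper_map_def closed_map_def)
qed


section \<open>The isometry group of a proper metric space\<close>

text \<open>The isometry group is studied through an isomorphic copy \<open>G\<close> of arbitrary element type, acting by
\<open>\<phi>\<close>. The identity model serves to bound the cardinality of the group, and after that a model on a set
of reals serves as the group that represents the space.\<close>

locale isometry_group_model = Metric_space M d + G: group G
  for M :: "'a set" and d and G :: "('g, 'm) monoid_scheme" (structure) +
  fixes \<phi> :: "'g \<Rightarrow> 'a \<Rightarrow> 'a" and D :: "'a set" and p :: 'a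
  assumes iso: "\<phi> \<in> iso G isometry_group"
    and D: "countable D" "D \<subseteq> M" "mtopology closure_of D = M"
    and proper: "proper_metric" and p: "p \<in> M"
begin

lemma \<phi>_hom: "\<phi> \<in> hom G isometry_group" and \<phi>_bij: "bij_betw \<phi> (carrier G) (carrier isometry_group)"
  using iso by (auto simp: iso_def)

lemma \<phi>_isometry: "g \<in> carrier G \<Longrightarrow> \<phi> g \<in> carrier isometry_group"
  using \<phi>_hom by (auto simp: hom_def)

lemma \<phi>_closed [simp]: "g \<in> carrier G \<Longrightarrow> x \<in> M \<Longrightarrow> \<phi> g x \<in> M"
  using \<phi>_isometry[of g] by (auto simp: isometry_group_def Bij_def bij_betw_def)

lemma \<phi>_dist: "g \<in> carrier G \<Longrightarrow> x \<in> M \<Longrightarrow> y \<in> M \<Longrightarrow> d (\<phi> g x) (\<phi> g y) = d x y"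
  using \<phi>_isometry[of g] by (auto simp: isometry_group_def)

lemma \<phi>_extensional: "g \<in> carrier G \<Longrightarrow> \<phi> g \<in> extensional M"
  using \<phi>_isometry[of g] by (auto simp: isometry_group_def Bij_def)

lemma \<phi>_action: "group_action G M \<phi>"
proof -
  have "\<phi> \<in> hom G (BijGroup M)"
    using \<phi>_hom by (auto simp: hom_def isometry_group_def BijGroup_def)
  then show ?thesis
    by (simp add: group_action_def group_hom_def group_hom_axioms_def group_BijGroup)
qed

lemma \<phi>_mult: "g \<in> carrier G \<Longrightarrow> h \<in> carrier G \<Longrightarrow> x \<in> M \<Longrightarrow> \<phi> (g \<otimes> h) x = \<phi> g (\<phi> h x)"
  using group_action.composition_rule[OF \<phi>_action] by blast

lemma \<phi>_one [simp]: "x \<in> M \<Longrightarrow> \<phi> \<one> x = x"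
  using group_action.id_eq_one[OF \<phi>_action] by (metis restrict_apply')

lemma \<phi>_inv_right: "g \<in> carrier G \<Longrightarrow> x \<in> M \<Longrightarrow> \<phi> g (\<phi> (inv g) x) = x"
  using \<phi>_mult[of g "inv g" x] by simp

lemma \<phi>_adjoint: "g \<in> carrier G \<Longrightarrow> x \<in> M \<Longrightarrow> y \<in> M \<Longrightarrow> d (\<phi> g x) y = d x (\<phi> (inv g) y)"
  using \<phi>_dist[of g x "\<phi> (inv g) y"] \<phi>_inv_right[of g y] by simp

text \<open>Convergence on a countable dense set is used for the definition because it makes the topology
metrizable. For isometries it amounts to convergence at every point, by \<open>continuous_joint_eval\<close>.\<close>

definition pointwise_topology :: "'g topology" where
  "pointwise_topology =
     pullback_topology (carrier G) (\<lambda>g. \<lambda>x\<in>D. \<phi> g x) (product_topology (\<lambda>_. mtopology) D)"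

lemma topspace_pointwise [simp]: "topspace pointwise_topology = carrier G"
  using subsetD[OF D(2)] by (auto simp: pointwise_topology_def topspace_pullback_topology PiE_def)

lemma dense_approx:
  assumes "x \<in> M" "r > 0"
  obtains e where "e \<in> D" "d x e < r"
  using D(3) assms by (auto simp: metric_closure_of)

lemma continuous_eval_dense:
  assumes "e \<in> D"
  shows "continuous_map pointwise_topology mtopology (\<lambda>g. \<phi> g e)"
proof -
  have "continuous_map pointwise_topology mtopology ((\<lambda>f. f e) \<circ> (\<lambda>g. \<lambda>x\<in>D. \<phi> g x))"
    unfolding pointwise_topology_def
    by (intro continuous_map_pullback continuous_map_product_projection assms)
  then show ?thesis using assms by (simp add: o_def)
qed

text \<open>A point near \<open>x\<close> is close to some \<open>e\<close> in the dense set, and isometries carry this closeness along. So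
controlling an isometry at \<open>e\<close> controls it near \<open>x\<close>; four steps of size \<open>\<epsilon> / 4\<close> suffice.\<close>

lemma continuous_joint_eval:
  "continuous_map (prod_topology pointwise_topology mtopology) mtopology (\<lambda>(g, x). \<phi> g x)"
  unfolding continuous_map_to_metric
proof (intro ballI allI impI)
  fix q and \<epsilon> :: real assume q: "q \<in> topspace (prod_topology pointwise_topology mtopology)" and \<epsilon>: "\<epsilon> > 0"
  obtain g x where [simp]: "q = (g, x)" by force
  have gx: "g \<in> carrier G" "x \<in> M" using q by auto
  obtain e where e: "e \<in> D" "d x e < \<epsilon> / 4" using dense_approx[of x "\<epsilon> / 4"] gx \<epsilon> by auto
  have eM: "e \<in> M" using e D by blast
  let ?N = "{h \<in> carrier G. \<phi> h e \<in> mball (\<phi> g e) (\<epsilon> / 4)}"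
  have N: "openin pointwise_topology ?N"
    using openin_continuous_map_preimage[OF continuous_eval_dense[OF e(1)] openin_mball]
    by (simp del: in_mball)
  have "\<phi> h y \<in> mball (\<phi> g x) \<epsilon>" if h: "h \<in> ?N" and y: "y \<in> mball x (\<epsilon> / 4)" for h y
  proof -
    have hG: "h \<in> carrier G" and yM: "y \<in> M" using h y by auto
    have "d (\<phi> g x) (\<phi> g e) < \<epsilon> / 4" using \<phi>_dist e gx eM by simp
    moreover have "d (\<phi> g e) (\<phi> h e) < \<epsilon> / 4" using h by simp
    moreover have "d (\<phi> h e) (\<phi> h x) < \<epsilon> / 4" using \<phi>_dist[OF hG eM gx(2)] e commute by simp
    moreover have "d (\<phi> h x) (\<phi> h y) < \<epsilon> / 4" using \<phi>_dist[OF hG gx(2) yM] y by simp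
    moreover have "d (\<phi> g x) (\<phi> h y) \<le> d (\<phi> g x) (\<phi> g e) + d (\<phi> g e) (\<phi> h y)"
      using gx eM hG yM by (intro triangle) auto
    moreover have "d (\<phi> g e) (\<phi> h y) \<le> d (\<phi> g e) (\<phi> h e) + d (\<phi> h e) (\<phi> h y)"
      using gx eM hG yM by (intro triangle) auto
    moreover have "d (\<phi> h e) (\<phi> h y) \<le> d (\<phi> h e) (\<phi> h x) + d (\<phi> h x) (\<phi> h y)"
      using gx eM hG yM by (intro triangle) auto
    ultimately have "d (\<phi> g x) (\<phi> h y) < \<epsilon>" by linarith
    then show ?thesis using gx hG yM by simp
  qed
  moreover have "openin (prod_topology pointwise_topology mtopology) (?N \<times> mball x (\<epsilon> / 4))"
    using N by (simp add: openin_prod_Times_iff)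
  moreover have "q \<in> ?N \<times> mball x (\<epsilon> / 4)" using gx eM \<epsilon> by simp
  ultimately show "\<exists>U. openin (prod_topology pointwise_topology mtopology) U \<and> q \<in> U \<and>
      (\<forall>y\<in>U. (case y of (g, x) \<Rightarrow> \<phi> g x) \<in> mball (case q of (g, x) \<Rightarrow> \<phi> g x) \<epsilon>)"
    unfolding \<open>q = (g, x)\<close> split by (metis (no_types, lifting) SigmaE split)
qed

lemma continuous_action_compose:
  assumes "continuous_map Y pointwise_topology f" "continuous_map Y mtopology k"
  shows "continuous_map Y mtopology (\<lambda>y. \<phi> (f y) (k y))"
proof -
  have "continuous_map Y mtopology ((\<lambda>(g, x). \<phi> g x) \<circ> (\<lambda>y. (f y, k y)))"
    by (rule continuous_map_compose[OF _ continuous_joint_eval]) (intro continuous_map_pairedI assms)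
  then show ?thesis by (simp add: o_def)
qed

lemma continuous_eval:
  assumes "x \<in> M"
  shows "continuous_map pointwise_topology mtopology (\<lambda>g. \<phi> g x)"
proof -
  have "continuous_map pointwise_topology mtopology (\<lambda>_. x)" using assms by simp
  from continuous_action_compose[OF continuous_map_id[unfolded id_def] this] show ?thesis .
qed

lemma continuous_into_pointwise:
  assumes "\<And>y. y \<in> topspace Y \<Longrightarrow> f y \<in> carrier G"
    and "\<And>x. x \<in> M \<Longrightarrow> continuous_map Y mtopology (\<lambda>y. \<phi> (f y) x)"
  shows "continuous_map Y pointwise_topology f"
  unfolding pointwise_topology_def
proof (rule continuous_map_pullback')
  show "topspace Y \<subseteq> f -` carrier G" using assms(1) by blast
  have "continuous_map Y (product_topology (\<lambda>_. mtopology) D) (\<lambda>y. \<lambda>x\<in>D. \<phi> (f y) x)"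
    unfolding continuous_map_componentwise
  proof (intro conjI ballI)
    show "(\<lambda>y. \<lambda>x\<in>D. \<phi> (f y) x) ` topspace Y \<subseteq> extensional D" by auto
    fix x assume x: "x \<in> D"
    then have "continuous_map Y mtopology (\<lambda>y. \<phi> (f y) x)" using assms(2) D(2) by blast
    then show "continuous_map Y mtopology (\<lambda>y. (\<lambda>x\<in>D. \<phi> (f y) x) x)" using x by simp
  qed
  then show "continuous_map Y (product_topology (\<lambda>_. mtopology) D) ((\<lambda>g. \<lambda>x\<in>D. \<phi> g x) \<circ> f)"
    by (simp add: o_def)
qed

text \<open>Since \<open>d (inv h x) (inv g x) = d x (h (inv g x))\<close>, closeness of the inverses at \<open>x\<close> is closeness of
the isometries themselves at the point \<open>inv g x\<close>.\<close>

lemma continuous_inv_eval: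
  assumes x: "x \<in> M"
  shows "continuous_map pointwise_topology mtopology (\<lambda>g. \<phi> (inv g) x)"
  unfolding continuous_map_to_metric topspace_pointwise
proof (intro ballI allI impI)
  fix g and \<epsilon> :: real assume g: "g \<in> carrier G" and \<epsilon>: "\<epsilon> > 0"
  let ?y = "\<phi> (inv g) x"
  have y: "?y \<in> M" using g x by simp
  let ?U = "{h \<in> carrier G. \<phi> h ?y \<in> mball x \<epsilon>}"
  have "openin pointwise_topology ?U"
    using openin_continuous_map_preimage[OF continuous_eval[OF y] openin_mball] by simp
  moreover have "g \<in> ?U" using g x \<epsilon> by (simp add: \<phi>_inv_right)
  moreover have "\<phi> (inv h) x \<in> mball ?y \<epsilon>" if "h \<in> ?U" for h
    using that g x y \<phi>_adjoint[of h ?y x] by (simp add: commute)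
  ultimately show "\<exists>U. openin pointwise_topology U \<and> g \<in> U \<and> (\<forall>h\<in>U. \<phi> (inv h) x \<in> mball ?y \<epsilon>)"
    by blast
qed

lemma topological_group_pointwise: "topological_group G pointwise_topology"
proof unfold_locales
  show "topspace pointwise_topology = carrier G" by simp
  show "continuous_map (prod_topology pointwise_topology pointwise_topology) pointwise_topology
      (\<lambda>(g, h). g \<otimes> h)"
  proof (rule continuous_into_pointwise)
    fix x assume x: "x \<in> M"
    let ?P = "prod_topology pointwise_topology pointwise_topology"
    have "continuous_map ?P mtopology (\<lambda>q. \<phi> (fst q) (\<phi> (snd q) x))"
      using x by (intro continuous_action_compose continuous_map_fst continuous_map_snd) simp
    then show "continuous_map ?P mtopology (\<lambda>q. \<phi> (case q of (g, h) \<Rightarrow> g \<otimes> h) x)"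
      by (rule continuous_map_eq) (use x \<phi>_mult in auto)
  qed auto
  show "continuous_map pointwise_topology pointwise_topology (\<lambda>g. inv g)"
    by (rule continuous_into_pointwise) (auto intro: continuous_inv_eval)
qed

sublocale topological_group G pointwise_topology by (rule topological_group_pointwise)

text \<open>By continuity an isometry is determined by its values on a dense set, and \<open>\<phi>\<close> is faithful.\<close>

lemma eval_inj_on_dense: "inj_on (\<lambda>g. \<lambda>x\<in>D. \<phi> g x) (carrier G)"
proof
  fix g h assume gh: "g \<in> carrier G" "h \<in> carrier G"
    and eq: "(\<lambda>x\<in>D. \<phi> g x) = (\<lambda>x\<in>D. \<phi> h x)"
  have "\<phi> g x = \<phi> h x" if x: "x \<in> M" for x
  proof -
    have "d (\<phi> g x) (\<phi> h x) \<le> 0"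
    proof (rule field_le_epsilon)
      fix \<epsilon> :: real assume "\<epsilon> > 0"
      then obtain e where e: "e \<in> D" "d x e < \<epsilon> / 2" using dense_approx[of x "\<epsilon> / 2"] x by auto
      have eM: "e \<in> M" using e D by blast
      have "\<phi> g e = \<phi> h e" using fun_cong[OF eq, of e] e by simp
      then have "d (\<phi> g x) (\<phi> h x) \<le> d (\<phi> g x) (\<phi> g e) + d (\<phi> h e) (\<phi> h x)"
        using triangle[of "\<phi> g x" "\<phi> g e" "\<phi> h x"] x eM gh by simp
      then show "d (\<phi> g x) (\<phi> h x) \<le> 0 + \<epsilon>" using x eM gh e(2) by (simp add: \<phi>_dist commute)
    qed
    moreover have "0 \<le> d (\<phi> g x) (\<phi> h x)" by simp
    ultimately have "d (\<phi> g x) (\<phi> h x) = 0" by linarith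
    then show ?thesis using x gh zero[of "\<phi> g x" "\<phi> h x"] by simp
  qed
  then have "\<phi> g = \<phi> h"
    by (rule extensionalityI[OF \<phi>_extensional[OF gh(1)] \<phi>_extensional[OF gh(2)]])
  then show "g = h" using \<phi>_bij gh by (meson bij_betw_imp_inj_on inj_onD)
qed

lemma metrizable_pointwise: "metrizable_space pointwise_topology"
proof -
  let ?f = "\<lambda>g. \<lambda>x\<in>D. \<phi> g x"
  have "countable {x \<in> D. \<nexists>a. topspace mtopology \<subseteq> {a}}" using D(1) by (rule countable_subset[rotated]) auto
  then have "metrizable_space (product_topology (\<lambda>_. mtopology) D)"
    by (simp add: metrizable_space_product_topology metrizable_space_mtopology)
  moreover have "?f ` carrier G \<subseteq> topspace (product_topology (\<lambda>_. mtopology) D)"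
    using D(2) by auto
  then have "pointwise_topology homeomorphic_space
      subtopology (product_topology (\<lambda>_. mtopology) D) (?f ` carrier G)"
    unfolding pointwise_topology_def
    using homeomorphic_map_pullback_topology[OF eval_inj_on_dense] homeomorphic_map_imp_homeomorphic_space
    by blast
  ultimately show ?thesis
    using homeomorphic_metrizable_space metrizable_space_subtopology by blast
qed

lemma compactin_mcball: "compactin mtopology (mcball x r)"
proof (cases "x \<in> M")
  case True
  have "mcball x r \<subseteq> mball x (r + 1)" by auto
  also have "\<dots> \<subseteq> mtopology closure_of mball x (r + 1)" by (rule closure_of_subset) auto
  finally show ?thesis
    using proper True closed_compactin closedin_mcball unfolding proper_metric_def by blast
next
  case False
  then have "mcball x r = {}" by auto
  then show ?thesis by simp
qed

definition bounded_displacement :: "real \<Rightarrow> 'g set" where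
  "bounded_displacement r = {g \<in> carrier G. d (\<phi> g p) p \<le> r}"

text \<open>The pairs \<open>(f, h)\<close> of mutually inverse isometries of bounded displacement, described by the equation
\<open>d (f z) x = d z (h x)\<close>. Each instance of this equation involves one value of \<open>f\<close> and one of \<open>h\<close>, so it is a
closed condition for pointwise convergence, unlike surjectivity of \<open>f\<close>.\<close>

definition adjoint_pairs :: "real \<Rightarrow> (('a \<Rightarrow> 'a) \<times> ('a \<Rightarrow> 'a)) set" where
  "adjoint_pairs r = {(f, h). f \<in> M \<rightarrow>\<^sub>E M \<and> h \<in> M \<rightarrow>\<^sub>E M \<and>
     (\<forall>x\<in>M. \<forall>z\<in>M. d (f z) x = d z (h x)) \<and> d (f p) p \<le> r}"

text \<open>Setting \<open>z = h x\<close> or \<open>x = f z\<close> in the adjointness equation shows that \<open>f\<close> and \<open>h\<close> are mutually inverse;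
setting \<open>x = f w\<close> then shows that \<open>f\<close> is an isometry.\<close>

lemma adjoint_pairs_eq:
  "adjoint_pairs r = (\<lambda>g. (\<lambda>x\<in>M. \<phi> g x, \<lambda>x\<in>M. \<phi> (inv g) x)) ` bounded_displacement r"
proof (intro subset_antisym subsetI)
  fix q assume "q \<in> adjoint_pairs r"
  then obtain f h where q: "q = (f, h)" and f: "f \<in> M \<rightarrow>\<^sub>E M" and h: "h \<in> M \<rightarrow>\<^sub>E M"
    and adj: "\<And>x z. x \<in> M \<Longrightarrow> z \<in> M \<Longrightarrow> d (f z) x = d z (h x)" and r: "d (f p) p \<le> r"
    by (auto simp: adjoint_pairs_def)
  have fM: "f x \<in> M" and hM: "h x \<in> M" if "x \<in> M" for x using f h that by auto
  have fh: "f (h x) = x" if x: "x \<in> M" for x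
    using adj[OF x hM[OF x]] fM[OF hM[OF x]] hM[OF x] x by simp
  have hf: "h (f x) = x" if x: "x \<in> M" for x
    using adj[OF fM[OF x] x] hM[OF fM[OF x]] fM[OF x] x by simp
  have "bij_betw f M M" by (rule bij_betw_byWitness[where f' = h]) (use fh hf fM hM in blast)+
  moreover have "d (f x) (f y) = d x y" if "x \<in> M" "y \<in> M" for x y
    using adj[of "f y" x] hf fM that by simp
  moreover have "f \<in> extensional M" using f by (simp add: PiE_iff)
  ultimately have "f \<in> carrier isometry_group" by (simp add: isometry_group_def Bij_def)
  then obtain g where g: "g \<in> carrier G" "f = \<phi> g" using \<phi>_bij by (auto simp: bij_betw_def)
  have "(\<lambda>x\<in>M. \<phi> g x) = f" using g \<phi>_extensional by (simp add: extensional_restrict)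
  moreover have "(\<lambda>x\<in>M. \<phi> (inv g) x) = h"
  proof
    fix x show "(\<lambda>x\<in>M. \<phi> (inv g) x) x = h x"
    proof (cases "x \<in> M")
      case True
      have "d (h x) (\<phi> (inv g) x) = d (\<phi> g (h x)) x" using \<phi>_adjoint[OF g(1) hM[OF True] True] by simp
      also have "\<dots> = 0" using fh[OF True] g True by simp
      finally show ?thesis using True hM g by simp
    next
      case False
      then show ?thesis using h by (simp add: PiE_def extensional_def)
    qed
  qed
  moreover have "g \<in> bounded_displacement r" using g r by (simp add: bounded_displacement_def)
  ultimately show "q \<in> (\<lambda>g. (\<lambda>x\<in>M. \<phi> g x, \<lambda>x\<in>M. \<phi> (inv g) x)) ` bounded_displacement r"
    unfolding q by (intro image_eqI[of _ _ g]) simp_all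
next
  fix q assume "q \<in> (\<lambda>g. (\<lambda>x\<in>M. \<phi> g x, \<lambda>x\<in>M. \<phi> (inv g) x)) ` bounded_displacement r"
  then obtain g where g: "g \<in> carrier G" "d (\<phi> g p) p \<le> r" "q = (\<lambda>x\<in>M. \<phi> g x, \<lambda>x\<in>M. \<phi> (inv g) x)"
    by (auto simp: bounded_displacement_def)
  then show "q \<in> adjoint_pairs r" using p \<phi>_adjoint[OF g(1)] by (simp add: adjoint_pairs_def)
qed

text \<open>The Arzela-Ascoli step: the pairs form a closed subset of a product of closed balls, which is compact
by Tychonoff's theorem because the metric is proper.\<close>

lemma compactin_adjoint_pairs:
  defines "P \<equiv> product_topology (\<lambda>_. mtopology) M"
  shows "compactin (prod_topology P P) (adjoint_pairs r)"
proof -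
  let ?PP = "prod_topology P P"
  let ?B = "PiE M (\<lambda>x. mcball p (r + d p x))"
  have B: "compactin P ?B" unfolding P_def compactin_PiE using compactin_mcball by blast
  have top: "topspace ?PP = (M \<rightarrow>\<^sub>E M) \<times> (M \<rightarrow>\<^sub>E M)" by (simp add: P_def)
  have sub: "adjoint_pairs r \<subseteq> ?B \<times> ?B"
  proof
    fix q assume "q \<in> adjoint_pairs r"
    then obtain g where g: "g \<in> carrier G" "d (\<phi> g p) p \<le> r" "q = (\<lambda>x\<in>M. \<phi> g x, \<lambda>x\<in>M. \<phi> (inv g) x)"
      unfolding adjoint_pairs_eq by (auto simp: bounded_displacement_def)
    have bd: "\<phi> k x \<in> mcball p (r + d p x)" if k: "k \<in> carrier G" "d (\<phi> k p) p \<le> r" and x: "x \<in> M" for k x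
    proof -
      have "d p (\<phi> k x) \<le> d p (\<phi> k p) + d (\<phi> k p) (\<phi> k x)" using k x p by (intro triangle) auto
      then show ?thesis using k x p by (simp add: \<phi>_dist commute)
    qed
    have "d (\<phi> (inv g) p) p \<le> r" using \<phi>_adjoint[OF g(1) p p] g by (simp add: commute)
    then show "q \<in> ?B \<times> ?B" using g bd[of g] bd[of "inv g"] by (simp add: PiE_def Pi_def)
  qed
  have fst_c: "continuous_map ?PP mtopology (\<lambda>q. fst q x)"
    and snd_c: "continuous_map ?PP mtopology (\<lambda>q. snd q x)" if x: "x \<in> M" for x
  proof -
    have e: "continuous_map P mtopology (\<lambda>f. f x)"
      unfolding P_def using x by (rule continuous_map_product_projection)
    show "continuous_map ?PP mtopology (\<lambda>q. fst q x)"
      using continuous_map_compose[OF continuous_map_fst e] by (simp add: o_def)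
    show "continuous_map ?PP mtopology (\<lambda>q. snd q x)"
      using continuous_map_compose[OF continuous_map_snd e] by (simp add: o_def)
  qed
  have dist_c: "continuous_map ?PP euclideanreal (\<lambda>q. d (f q) (k q))"
    if "continuous_map ?PP mtopology f" "continuous_map ?PP mtopology k" for f k
    using continuous_map_mdist[of ?PP "metric (M, d)" f k] that by (simp add: mtopology_of)
  let ?A = "\<lambda>x z. {q \<in> topspace ?PP. d (fst q z) x - d z (snd q x) \<in> {0}}"
  let ?C = "{q \<in> topspace ?PP. d (fst q p) p \<in> {..r}}"
  have A: "closedin ?PP (?A x z)" if "x \<in> M" "z \<in> M" for x z
    by (rule closedin_continuous_map_preimage[of _ euclideanreal])
      (use that fst_c snd_c in \<open>auto intro!: continuous_map_diff dist_c\<close>)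
  have C: "closedin ?PP ?C"
    by (rule closedin_continuous_map_preimage[of _ euclideanreal])
      (use p fst_c in \<open>auto intro!: dist_c\<close>)
  have "closedin ?PP (\<Inter>(insert ?C ((\<lambda>(x, z). ?A x z) ` (M \<times> M))))"
    by (rule closedin_Inter) (use A C in auto)
  moreover have "\<Inter>(insert ?C ((\<lambda>(x, z). ?A x z) ` (M \<times> M))) = adjoint_pairs r"
    unfolding top adjoint_pairs_def by auto
  ultimately have "closedin ?PP (adjoint_pairs r)" by simp
  moreover have "compactin ?PP (?B \<times> ?B)" using B by (simp add: compactin_Times)
  ultimately show ?thesis using closed_compactin sub by blast
qed

text \<open>Pulling the compact set of adjoint pairs back along \<open>g \<mapsto> (g, inv g)\<close> gives a compact set in a
topology that is at least as fine as the pointwise one.\<close>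

lemma compactin_bounded_displacement: "compactin pointwise_topology (bounded_displacement r)"
proof -
  let ?P = "product_topology (\<lambda>_. mtopology) M"
  let ?J = "\<lambda>g. (\<lambda>x\<in>M. \<phi> g x, \<lambda>x\<in>M. \<phi> (inv g) x)"
  let ?T = "pullback_topology (carrier G) ?J (prod_topology ?P ?P)"
  have im: "?J ` carrier G \<subseteq> topspace (prod_topology ?P ?P)" by auto
  have inj: "inj_on ?J (carrier G)"
  proof
    fix g h assume gh: "g \<in> carrier G" "h \<in> carrier G" and eq: "?J g = ?J h"
    then have "(\<lambda>x\<in>M. \<phi> g x) = (\<lambda>x\<in>M. \<phi> h x)" by simp
    then have "(\<lambda>x\<in>D. \<phi> g x) = (\<lambda>x\<in>D. \<phi> h x)" using D(2) by (metis (no_types) restrict_apply' restrict_ext subsetD)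
    then show "g = h" using inj_onD[OF eval_inj_on_dense] gh by blast
  qed
  have "compactin ?T (bounded_displacement r)"
    by (rule compactin_pullback_topology[OF inj im])
      (use compactin_adjoint_pairs[of r] in \<open>auto simp: adjoint_pairs_eq bounded_displacement_def\<close>)
  moreover have "continuous_map ?T pointwise_topology (\<lambda>g. g)"
  proof (rule continuous_into_pointwise)
    show "g \<in> carrier G" if "g \<in> topspace ?T" for g using that by (auto simp: topspace_pullback_topology)
    fix x assume x: "x \<in> M"
    have "continuous_map (prod_topology ?P ?P) mtopology ((\<lambda>f. f x) \<circ> fst)"
      by (rule continuous_map_compose[OF continuous_map_fst continuous_map_product_projection[OF x]])
    then have "continuous_map ?T mtopology (((\<lambda>f. f x) \<circ> fst) \<circ> ?J)" by (rule continuous_map_pullback)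
    then show "continuous_map ?T mtopology (\<lambda>g. \<phi> g x)" using x by (simp add: o_def)
  qed
  ultimately have "compactin pointwise_topology ((\<lambda>g. g) ` bounded_displacement r)"
    by (rule image_compactin)
  then show ?thesis by simp
qed

lemma locally_compact_pointwise: "locally_compact_space pointwise_topology"
  unfolding locally_compact_space_def topspace_pointwise
proof
  fix g assume g: "g \<in> carrier G"
  let ?r = "d (\<phi> g p) p + 1"
  let ?U = "{h \<in> carrier G. \<phi> h p \<in> mball p ?r}"
  have "openin pointwise_topology ?U"
    using openin_continuous_map_preimage[OF continuous_eval[OF p] openin_mball] by simp
  moreover have "g \<in> ?U" using g p by (simp add: commute)
  moreover have "?U \<subseteq> bounded_displacement ?r" using p by (auto simp: bounded_displacement_def commute)
  ultimately show "\<exists>U K. openin pointwise_topology U \<and> compactin pointwise_topology K \<and> g \<in> U \<and> U \<subseteq> K"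
    using compactin_bounded_displacement by blast
qed

lemma separable_pointwise: "separable_space pointwise_topology"
proof (rule sigma_compact_metrizable_imp_separable[OF metrizable_pointwise])
  show "compactin pointwise_topology (bounded_displacement (real n))" for n
    by (rule compactin_bounded_displacement)
  show "topspace pointwise_topology \<subseteq> (\<Union>n. bounded_displacement (real n))"
    using real_arch_simple by (auto simp: bounded_displacement_def)
qed

lemma locally_compact_mtopology: "locally_compact_space mtopology"
  unfolding locally_compact_space_def topspace_mtopology
proof
  fix x assume "x \<in> M"
  then have "openin mtopology (mball x 1) \<and> compactin mtopology (mcball x 1) \<and> x \<in> mball x 1 \<and>
      mball x 1 \<subseteq> mcball x 1"
    using compactin_mcball by auto
  then show "\<exists>U K. openin mtopology U \<and> compactin mtopology K \<and> x \<in> U \<and> U \<subseteq> K" by blast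
qed

lemma compactin_bounded_by_point:
  assumes "compactin mtopology K"
  obtains r where "\<And>x. x \<in> K \<Longrightarrow> d p x \<le> r"
proof -
  obtain c B where c: "K \<subseteq> mcball c B"
    using compactin_imp_mbounded[OF assms] by (auto simp: mbounded_def)
  have "d p x \<le> d p c + B" if "x \<in> K" for x
    using c that p triangle[of p c x] by fastforce
  then show ?thesis by (rule that)
qed

text \<open>If \<open>(g x, x)\<close> stays in a compact set, then \<open>x\<close> stays in a ball about \<open>p\<close> and the displacement of \<open>p\<close> under
\<open>g\<close> stays bounded. So preimages of compact sets are compact, and in a locally compact Hausdorff
target this makes the map perfect.\<close>

lemma proper_action_map:
  "proper_map (prod_topology pointwise_topology mtopology) (prod_topology mtopology mtopology)
     (\<lambda>(g, x). (\<phi> g x, x))" (is "proper_map ?S ?X ?F")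
proof (rule compact_imp_proper_map)
  show "k_space ?X"
    using k_space_prod_topology_left[OF locally_compact_mtopology] Hausdorff_space_mtopology
      locally_compact_imp_k_space[OF locally_compact_mtopology] by blast
  show "kc_space ?X"
    using Hausdorff_imp_kc_space Hausdorff_space_mtopology Hausdorff_space_prod_topology by blast
  show "?F \<in> topspace ?S \<rightarrow> topspace ?X" by auto
  have cont: "continuous_map ?S ?X ?F"
  proof -
    have "continuous_map ?S ?X (\<lambda>q. ((\<lambda>(g, x). \<phi> g x) q, snd q))"
      by (intro continuous_map_pairedI continuous_joint_eval continuous_map_snd)
    then show ?thesis by (simp add: case_prod_unfold)
  qed
  then show "continuous_map ?S ?X ?F \<or> kc_space ?S" by simp
  fix K assume K: "compactin ?X K"
  have "compactin mtopology (fst ` K)" "compactin mtopology (snd ` K)"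
    using image_compactin[OF K continuous_map_fst] image_compactin[OF K continuous_map_snd] by auto
  then obtain r s where r: "\<And>x. x \<in> fst ` K \<Longrightarrow> d p x \<le> r" and s: "\<And>x. x \<in> snd ` K \<Longrightarrow> d p x \<le> s"
    using compactin_bounded_by_point by metis
  have "{q \<in> topspace ?S. ?F q \<in> K} \<subseteq> bounded_displacement (r + s) \<times> mcball p s"
  proof
    fix q assume q: "q \<in> {q \<in> topspace ?S. ?F q \<in> K}"
    obtain g x where [simp]: "q = (g, x)" by force
    have gx: "g \<in> carrier G" "x \<in> M" and K': "(\<phi> g x, x) \<in> K" using q by auto
    have 1: "d p (\<phi> g x) \<le> r" using r K' by force
    have 2: "d p x \<le> s" using s K' by force
    have "d (\<phi> g p) p \<le> d (\<phi> g p) (\<phi> g x) + d (\<phi> g x) p" using gx p by (intro triangle) auto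
    then have "d (\<phi> g p) p \<le> r + s" using 1 2 gx p by (simp add: \<phi>_dist commute)
    then show "q \<in> bounded_displacement (r + s) \<times> mcball p s"
      using gx p 2 by (simp add: bounded_displacement_def)
  qed
  moreover have "compactin ?S (bounded_displacement (r + s) \<times> mcball p s)"
    using compactin_bounded_displacement compactin_mcball by (simp add: compactin_Times)
  moreover have "closedin ?X K"
    using compactin_imp_closedin[OF _ K] Hausdorff_space_mtopology by (simp add: Hausdorff_space_prod_topology)
  then have "closedin ?S {q \<in> topspace ?S. ?F q \<in> K}" by (rule closedin_continuous_map_preimage[OF cont])
  ultimately show "compactin ?S {q \<in> topspace ?S. ?F q \<in> K}" using closed_compactin by blast
qed

lemma proper_action_pointwise: "proper_action G pointwise_topology mtopology \<phi>"
proof -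
  have "continuous_map (prod_topology pointwise_topology mtopology) (prod_topology mtopology mtopology)
      (\<lambda>q. ((\<lambda>(g, x). \<phi> g x) q, snd q))"
    by (intro continuous_map_pairedI continuous_joint_eval continuous_map_snd)
  then show ?thesis
    using \<phi>_action continuous_joint_eval proper_action_map
    by (simp add: proper_action_def continuous_action_def case_prod_unfold)
qed

end


section \<open>Spaces as cosets of their isometry groups\<close>

text \<open>The orbit map and the projection to cosets are quotient maps of the group with the same fibres, so
they differ by a homeomorphism of their targets. This homeomorphism is equivariant and carries the proper action
over to the cosets.\<close>

theorem (in topological_group) proper_coset_space_stabilizer:
  assumes lc: "locally_compact_space T" and sep: "separable_space T" and met: "metrizable_space T"
    and X: "Hausdorff_space X" and p: "p \<in> topspace X"
    and act: "proper_action G T X \<phi>" and orbit: "quotient_map T X (\<lambda>g. \<phi> g p)"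
  shows "proper_coset_space G T (stabilizer G \<phi> p) X"
proof -
  let ?H = "stabilizer G \<phi> p"
  let ?Y = "coset_topology G T ?H"
  let ?c = "\<lambda>g. g <#\<^bsub>G\<^esub> ?H"
  have gact: "group_action G (topspace X) \<phi>"
    and cact: "continuous_map (prod_topology T X) X (\<lambda>(g, x). \<phi> g x)"
    and cF: "continuous_map (prod_topology T X) (prod_topology X X) (\<lambda>(g, x). (\<phi> g x, x))"
    and pF: "proper_map (prod_topology T X) (prod_topology X X) (\<lambda>(g, x). (\<phi> g x, x))"
    using act by (auto simp: proper_action_def continuous_action_def)
  have H: "subgroup ?H G" using group_action.stabilizer_subgroup[OF gact p] .
  have Hsub: "?H \<subseteq> carrier G" using subgroup.subset[OF H] .
  have mult: "\<phi> (g \<otimes> h) x = \<phi> g (\<phi> h x)" if "g \<in> carrier G" "h \<in> carrier G" "x \<in> topspace X" for g h x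
    using group_action.composition_rule[OF gact that(3,1,2)] .
  have orb: "\<phi> g x \<in> topspace X" if "g \<in> carrier G" "x \<in> topspace X" for g x
    using group_action.element_image[OF gact that refl] .
  have Hclosed: "closedin T ?H"
  proof -
    have "closedin X {p}"
      using t1_space_closedin_singleton[of X] Hausdorff_imp_t1_space[OF X] p by simp
    then have "closedin T {g \<in> topspace T. \<phi> g p \<in> {p}}"
      by (rule closedin_continuous_map_preimage[OF quotient_imp_continuous_map[OF orbit]])
    then show ?thesis by (simp add: stabilizer_def topspace_eq_carrier)
  qed
  have fib: "\<phi> g p = \<phi> h p \<longleftrightarrow> ?c g = ?c h" if gh: "g \<in> carrier G" "h \<in> carrier G" for g h
  proof -
    have "\<phi> (inv g) (\<phi> g p) = p" using mult[of "inv g" g p] gh p group_action.id_eq_one[OF gact]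
      by (metis inv_closed l_inv restrict_apply')
    moreover have "\<phi> g (\<phi> (inv g \<otimes> h) p) = \<phi> h p"
      using mult[of g "inv g \<otimes> h" p] gh p mult_inv_cancel by simp
    moreover have "\<phi> (inv g \<otimes> h) p = \<phi> (inv g) (\<phi> h p)" using mult gh p by simp
    ultimately have "\<phi> g p = \<phi> h p \<longleftrightarrow> \<phi> (inv g \<otimes> h) p = p" by metis
    also have "\<dots> \<longleftrightarrow> inv g \<otimes> h \<in> ?H" using gh by (simp add: stabilizer_def)
    also have "\<dots> \<longleftrightarrow> ?c g = ?c h" using l_coset_eq_iff[OF H gh] by simp
    finally show ?thesis .
  qed
  have cq: "quotient_map T ?Y ?c" by (rule quotient_map_coset_topology[OF topspace_eq_carrier])
  have orbG: "x \<in> topspace X \<Longrightarrow> \<exists>g\<in>carrier G. x = \<phi> g p" for x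
    using quotient_imp_surjective_map[OF orbit] topspace_eq_carrier by auto
  have topY: "topspace ?Y = ?c ` carrier G"
    using quotient_imp_surjective_map[OF cq] topspace_eq_carrier by auto
  obtain k where k: "continuous_map X ?Y k" "\<And>g. g \<in> carrier G \<Longrightarrow> k (\<phi> g p) = ?c g"
    using quotient_map_lift_exists[OF orbit quotient_imp_continuous_map[OF cq]] fib
    unfolding topspace_eq_carrier by metis
  obtain l where l: "continuous_map ?Y X l" "\<And>g. g \<in> carrier G \<Longrightarrow> l (?c g) = \<phi> g p"
    using quotient_map_lift_exists[OF cq quotient_imp_continuous_map[OF orbit]] fib
    unfolding topspace_eq_carrier by metis
  have kl: "homeomorphic_maps X ?Y k l"
    unfolding homeomorphic_maps_def
  proof (intro conjI ballI k(1) l(1))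
    show "l (k x) = x" if "x \<in> topspace X" for x using orbG[OF that] k(2) l(2) by auto
    show "k (l C) = C" if "C \<in> topspace ?Y" for C using that k(2) l(2) unfolding topY by auto
  qed
  have homeo: "X homeomorphic_space ?Y" using kl homeomorphic_space_def by blast
  have equiv: "coset_action G ?H g C = k (\<phi> g (l C))" if g: "g \<in> carrier G" and C: "C \<in> topspace ?Y" for g C
  proof -
    obtain a where a: "a \<in> carrier G" "C = ?c a" using C topY by blast
    have "coset_action G ?H g C = ?c (g \<otimes> a)" using coset_action_coset[OF Hsub g a(1)] a(2) by simp
    also have "\<dots> = k (\<phi> (g \<otimes> a) p)" using k(2) g a by simp
    also have "\<dots> = k (\<phi> g (l C))" using mult[OF g a(1) p] l(2) a by simp
    finally show ?thesis .
  qed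
  let ?L = "\<lambda>(g, C). (g, l C)"
  let ?K = "\<lambda>(x, y). (k x, k y)"
  let ?F = "\<lambda>(g, x). (\<phi> g x, x)"
  have kc: "continuous_map X ?Y k" and lp: "proper_map ?Y X l" and kp: "proper_map X ?Y k"
    using kl homeomorphic_maps_imp_map homeomorphic_maps_sym homeomorphic_imp_proper_map k(1) by metis+
  have Lc: "continuous_map (prod_topology T ?Y) (prod_topology T X) ?L"
  proof -
    have "continuous_map (prod_topology T ?Y) (prod_topology T X) (\<lambda>q. (fst q, (l \<circ> snd) q))"
      by (intro continuous_map_pairedI continuous_map_fst continuous_map_compose[OF continuous_map_snd l(1)])
    then show ?thesis by (simp add: case_prod_unfold)
  qed
  have Kc: "continuous_map (prod_topology X X) (prod_topology ?Y ?Y) ?K"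
  proof -
    have "continuous_map (prod_topology X X) (prod_topology ?Y ?Y) (\<lambda>q. ((k \<circ> fst) q, (k \<circ> snd) q))"
      by (intro continuous_map_pairedI continuous_map_compose[OF continuous_map_fst kc]
          continuous_map_compose[OF continuous_map_snd kc])
    then show ?thesis by (simp add: case_prod_unfold)
  qed
  have Lp: "proper_map (prod_topology T ?Y) (prod_topology T X) ?L"
    using proper_map_prod[of T ?Y T X "\<lambda>g. g" l] lp proper_map_id[of T] by (simp add: id_def)
  have Kp: "proper_map (prod_topology X X) (prod_topology ?Y ?Y) ?K"
    using proper_map_prod[of X X ?Y ?Y k k] kp by simp
  have eqF: "(?K \<circ> ?F \<circ> ?L) q = (\<lambda>(g, C). (coset_action G ?H g C, C)) q"
    if "q \<in> topspace (prod_topology T ?Y)" for q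
    using that equiv kl by (auto simp: topspace_eq_carrier homeomorphic_maps_def)
  have "continuous_map (prod_topology T ?Y) (prod_topology ?Y ?Y) (?K \<circ> ?F \<circ> ?L)"
    by (intro continuous_map_compose[OF Lc] continuous_map_compose[OF cF Kc])
  then have cont: "continuous_map (prod_topology T ?Y) (prod_topology ?Y ?Y)
      (\<lambda>(g, C). (coset_action G ?H g C, C))"
    by (rule continuous_map_eq) (rule eqF)
  have "proper_map (prod_topology T ?Y) (prod_topology ?Y ?Y) (?K \<circ> ?F \<circ> ?L)"
    by (intro proper_map_compose[OF Lp] proper_map_compose[OF pF Kp])
  then have proper: "proper_map (prod_topology T ?Y) (prod_topology ?Y ?Y)
      (\<lambda>(g, C). (coset_action G ?H g C, C))"
    by (rule proper_map_cong) (rule eqF)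
  have "continuous_map (prod_topology T ?Y) ?Y (fst \<circ> (\<lambda>(g, C). (coset_action G ?H g C, C)))"
    by (rule continuous_map_compose[OF cont continuous_map_fst])
  then have "continuous_map (prod_topology T ?Y) ?Y (\<lambda>(g, C). coset_action G ?H g C)"
    by (simp add: o_def case_prod_unfold)
  moreover have "group_action G (topspace ?Y) (coset_action G ?H)"
    using group_action_coset_action[OF Hsub] by (simp add: topspace_coset_topology topspace_eq_carrier)
  ultimately have "proper_action G T ?Y (coset_action G ?H)"
    using cont proper by (simp add: proper_action_def continuous_action_def)
  then show ?thesis
    using topological_group_axioms is_group H Hclosed homeo lc sep met
    by (simp add: proper_coset_space_def topological_group_def)
qed

context isometry_group_model
begin

text \<open>The orbit map is perfect, hence closed, because the preimage of a bounded set has bounded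
displacement.\<close>

lemma quotient_map_orbit:
  assumes "transitive_action isometry_group M (\<lambda>f. f)"
  shows "quotient_map pointwise_topology mtopology (\<lambda>g. \<phi> g p)"
proof (rule continuous_closed_imp_quotient_map)
  show cont: "continuous_map pointwise_topology mtopology (\<lambda>g. \<phi> g p)" by (rule continuous_eval[OF p])
  have "proper_map pointwise_topology mtopology (\<lambda>g. \<phi> g p)"
  proof (rule compact_imp_proper_map)
    show "k_space mtopology" using locally_compact_imp_k_space locally_compact_mtopology by blast
    show "kc_space mtopology" using Hausdorff_imp_kc_space Hausdorff_space_mtopology by blast
    show "(\<lambda>g. \<phi> g p) \<in> topspace pointwise_topology \<rightarrow> topspace mtopology" using p by simp
    show "continuous_map pointwise_topology mtopology (\<lambda>g. \<phi> g p) \<or> kc_space pointwise_topology"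
      using cont by blast
    fix K assume K: "compactin mtopology K"
    obtain r where r: "\<And>x. x \<in> K \<Longrightarrow> d p x \<le> r" using compactin_bounded_by_point[OF K] by blast
    have "closedin pointwise_topology {g \<in> topspace pointwise_topology. \<phi> g p \<in> K}"
      by (rule closedin_continuous_map_preimage[OF cont compactin_imp_closedin[OF Hausdorff_space_mtopology K]])
    moreover have "{g \<in> topspace pointwise_topology. \<phi> g p \<in> K} \<subseteq> bounded_displacement r"
    proof
      fix g assume "g \<in> {g \<in> topspace pointwise_topology. \<phi> g p \<in> K}"
      then show "g \<in> bounded_displacement r"
        using r[of "\<phi> g p"] commute[of p "\<phi> g p"] by (simp add: bounded_displacement_def)
    qed
    ultimately show "compactin pointwise_topology {g \<in> topspace pointwise_topology. \<phi> g p \<in> K}"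
      using closed_compactin[OF compactin_bounded_displacement] by blast
  qed
  then show "closed_map pointwise_topology mtopology (\<lambda>g. \<phi> g p)" by (rule proper_imp_closed_map)
  have "\<exists>g\<in>carrier G. \<phi> g p = x" if "x \<in> M" for x
  proof -
    obtain f where f: "f \<in> carrier isometry_group" "f p = x"
      using assms p \<open>x \<in> M\<close> transitive_isometry_group_iff by blast
    then show ?thesis using \<phi>_bij unfolding bij_betw_def by (metis imageE)
  qed
  then show "(\<lambda>g. \<phi> g p) ` topspace pointwise_topology = topspace mtopology" using p by force
qed

theorem proper_coset_space_isometry_group:
  assumes "transitive_action isometry_group M (\<lambda>f. f)"
  shows "proper_coset_space G pointwise_topology (stabilizer G \<phi> p) mtopology"
  using proper_coset_space_stabilizer[OF locally_compact_pointwise separable_pointwise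
      metrizable_pointwise Hausdorff_space_mtopology _ proper_action_pointwise
      quotient_map_orbit[OF assms]] p by simp

end

lemma (in group) image_group_iso:
  assumes "inj_on f (carrier G)"
  shows "group (image_group f G)" "inv_into (carrier G) f \<in> iso (image_group f G) G"
proof -
  have f: "f \<in> iso G (image_group f G)"
    using assms by (auto simp: iso_def hom_def image_group_def bij_betw_def)
  have "image_group f G = image_group f G\<lparr>one := f \<one>\<rparr>" by (simp add: image_group_def)
  then show "group (image_group f G)" using iso_imp_img_group[OF f] by simp
  show "inv_into (carrier G) f \<in> iso (image_group f G) G" by (rule iso_set_sym[OF f])
qed

text \<open>In its pointwise topology the isometry group is separable and metrizable, so it injects into the
reals. Its group structure is carried over to the image, and the copy represents the space.\<close>

theorem metrically_homogeneous_imp_proper_coset_space: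
  fixes X :: "'a topology"
  assumes ne: "topspace X \<noteq> {}" and sep: "separable_space X" and hom: "metrically_homogeneous_proper X"
  shows "\<exists>(G :: real monoid) T H. proper_coset_space G T H X"
proof -
  obtain \<rho> where \<rho>: "Metric_space (topspace X) \<rho>" "Metric_space.mtopology (topspace X) \<rho> = X"
    "Metric_space.proper_metric (topspace X) \<rho>"
    "transitive_action (Metric_space.isometry_group (topspace X) \<rho>) (topspace X) (\<lambda>f. f)"
    using hom by (auto simp: metrically_homogeneous_proper_def)
  interpret Metric_space "topspace X" \<rho> by fact
  obtain D where D: "countable D" "D \<subseteq> topspace X" "X closure_of D = topspace X"
    using sep by (auto simp: separable_space_def)
  obtain p where p: "p \<in> topspace X" using ne by blast
  have grp: "group isometry_group"
    using group_action_isometry_group by (simp add: group_action_def group_hom_def)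
  interpret I: isometry_group_model "topspace X" \<rho> isometry_group "\<lambda>f. f" D p
    using grp D \<rho> p
    by (simp add: isometry_group_model_def isometry_group_model_axioms_def Metric_space_axioms
        iso_def hom_def bij_betw_def group.is_monoid monoid.m_closed)
  have "carrier isometry_group \<lesssim> (UNIV :: real set)"
    using separable_metrizable_lepoll_reals[OF I.metrizable_pointwise I.separable_pointwise] by simp
  then obtain c :: "('a \<Rightarrow> 'a) \<Rightarrow> real" where c: "inj_on c (carrier isometry_group)"
    by (auto simp: lepoll_def)
  define G where "G = image_group c isometry_group"
  define \<phi> where "\<phi> = inv_into (carrier isometry_group) c"
  have G: "group G" "\<phi> \<in> iso G isometry_group"
    using group.image_group_iso[OF grp c] by (simp_all add: G_def \<phi>_def)
  interpret R: isometry_group_model "topspace X" \<rho> G \<phi> D p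
    using G D \<rho> p
    by (simp add: isometry_group_model_def isometry_group_model_axioms_def Metric_space_axioms)
  show ?thesis
    using R.proper_coset_space_isometry_group[OF \<rho>(4)] unfolding \<rho>(2) by blast
qed

(* HOL cannot quantify over all types inside a formula. A separable metrizable group has at most
   continuum many elements, so the reals suffice as a universe of group elements in the
   equivalence; the second conjunct gives the forward implication for groups on any type. *)
theorem theorem1p2:
  fixes X :: "'a topology"
  assumes "topspace X \<noteq> {}"
    and "locally_compact_space X" "separable_space X" "metrizable_space X"
  shows "((\<exists>(G :: real monoid) T H. proper_coset_space G T H X)
            \<longleftrightarrow> metrically_homogeneous_proper X)
       \<and> ((\<exists>(G :: 'g monoid) T H. proper_coset_space G T H X)
            \<longrightarrow> metrically_homogeneous_proper X)"
proof (intro conjI iffI impI)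
  show "metrically_homogeneous_proper X" if "\<exists>(G :: real monoid) T H. proper_coset_space G T H X"
    using that proper_coset_space_imp_metrically_homogeneous by blast
  show "metrically_homogeneous_proper X" if "\<exists>(G :: 'g monoid) T H. proper_coset_space G T H X"
    using that proper_coset_space_imp_metrically_homogeneous by blast
  show "\<exists>(G :: real monoid) T H. proper_coset_space G T H X" if "metrically_homogeneous_proper X"
    using metrically_homogeneous_imp_proper_coset_space[OF assms(1,3) that] .
qed

end
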